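(* Let $H$ be a graph with chromatic number $\chi(H)=3$. Then ${\delta_{\text{lin-rem}}}(H)=\frac12$ if $H$ has no critical edge; ${\delta_{\text{lin-rem}}}(H)=\frac13$ if $H$ has a critical edge and contains a triangle; and ${\delta_{\text{lin-rem}}}(H)=\frac14$ if $H$ has a critical edge and the odd girth of $H$ is at least $5$.
   Context: All graphs are finite and simple; "copies" of a fixed graph $H$ in a graph $G$ are labeled copies (injective maps $V(H)\to V(G)$ sending edges to edges). For a graph $H$, $\varepsilon>0$ and $\gamma\in[0,1]$, let $\delta(\varepsilon,H;\gamma)$ be the maximum $\delta\in[0,1]$ such that every $n$-vertex graph $G$ with minimum degree at least $\gamma n$ which contains $\varepsilon n^2$ edge-disjoint copies of $H$ contains at least $\delta n^{v(H)}$ copies of $H$. The linear removal threshold ${\delta_{\text{lin-rem}}}(H)$ is the infimum of those $\gamma$ for which there exists $\mu=\mu(\gamma)>0$ with $\delta(\varepsilon,H;\gamma)\geq\mu\varepsilon$ for all $\varepsilon>0$. An edge $xy$ of $H$ is critical if $\chi(H-xy)<\chi(H)$. The odd girth of $H$ is the length of a shortest odd cycle in $H$.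
   Formalization: The bound δ(ε,H;γ) ≥ με is required only for 0 < ε ≤ 1, not for all ε > 0: as δ ≤ 1 it fails for every large ε, while for ε > 1/2 no nonempty graph has εn² edge-disjoint copies. Host graphs G have natural numbers as vertices. *)

theory Defs
  imports
    Complex_Main
    "HOL-Library.FuncSet"
    "HOL-Library.Extended_Nat"
    "Graph_Theory.Pair_Digraph"
begin

text \<open>
  A finite simple graph is a \<open>pair_graph\<close>: a finite, loop-free digraph without parallel arcs whose
  arc relation is symmetric. The edge \<open>xy\<close> is the pair of arcs \<open>(x, y)\<close>, \<open>(y, x)\<close>, and the degree
  of a vertex is its out-degree.
\<close>

definition proper_colouring :: "'a pair_pre_digraph \<Rightarrow> nat \<Rightarrow> ('a \<Rightarrow> nat) \<Rightarrow> bool" where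
  "proper_colouring H k c \<longleftrightarrow>
     c \<in> pverts H \<rightarrow> {..<k} \<and> (\<forall>(x, y) \<in> parcs H. c x \<noteq> c y)"

definition chromatic_number :: "'a pair_pre_digraph \<Rightarrow> nat" where
  "chromatic_number H = (LEAST k. \<exists>c. proper_colouring H k c)"

definition delete_edge :: "'a pair_pre_digraph \<Rightarrow> 'a \<Rightarrow> 'a \<Rightarrow> 'a pair_pre_digraph" where
  "delete_edge H x y = H\<lparr>parcs := parcs H - {(x, y), (y, x)}\<rparr>"

definition critical_edge :: "'a pair_pre_digraph \<Rightarrow> 'a \<Rightarrow> 'a \<Rightarrow> bool" where
  "critical_edge H x y \<longleftrightarrow>
     (x, y) \<in> parcs H \<and> chromatic_number (delete_edge H x y) < chromatic_number H"

definition has_critical_edge :: "'a pair_pre_digraph \<Rightarrow> bool" where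
  "has_critical_edge H \<longleftrightarrow> (\<exists>x y. critical_edge H x y)"

definition contains_triangle :: "'a pair_pre_digraph \<Rightarrow> bool" where
  "contains_triangle H \<longleftrightarrow>
     (\<exists>x y z. (x, y) \<in> parcs H \<and> (y, z) \<in> parcs H \<and> (z, x) \<in> parcs H)"

text \<open>
  The library's \<open>cycle\<close> admits the closed walk \<open>x, y, x\<close>, but in a loop-free graph every cycle of
  odd length has length at least 3 and is a cycle of the undirected graph. The odd girth of a graph
  without odd cycles is \<open>\<infinity>\<close>.
\<close>

definition odd_girth :: "'a pair_pre_digraph \<Rightarrow> enat" where
  "odd_girth H =
     (INF p \<in> {p. pre_digraph.cycle (with_proj H) p \<and> odd (length p)}. enat (length p))"

definition copies :: "'a pair_pre_digraph \<Rightarrow> 'b pair_pre_digraph \<Rightarrow> ('a \<Rightarrow> 'b) set" where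
  "copies H G =
     {f \<in> pverts H \<rightarrow>\<^sub>E pverts G. inj_on f (pverts H) \<and> (\<forall>(x, y) \<in> parcs H. (f x, f y) \<in> parcs G)}"

definition edge_disjoint_copies ::
    "'a pair_pre_digraph \<Rightarrow> 'b pair_pre_digraph \<Rightarrow> ('a \<Rightarrow> 'b) set \<Rightarrow> bool" where
  "edge_disjoint_copies H G F \<longleftrightarrow>
     F \<subseteq> copies H G \<and>
     pairwise (\<lambda>f g. disjnt (map_prod f f ` parcs H) (map_prod g g ` parcs H)) F"

definition min_degree_ge :: "'a pair_pre_digraph \<Rightarrow> real \<Rightarrow> bool" where
  "min_degree_ge G d \<longleftrightarrow> (\<forall>v \<in> pverts G. d \<le> real (out_degree (with_proj G) v))"

text \<open>
  Host graphs have natural numbers as vertices; every finite graph is isomorphic to such a graph.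
\<close>

definition removal_bound :: "real \<Rightarrow> 'a pair_pre_digraph \<Rightarrow> real \<Rightarrow> real \<Rightarrow> bool" where
  "removal_bound \<epsilon> H \<gamma> \<delta> \<longleftrightarrow>
     (\<forall>G :: nat pair_pre_digraph. \<forall>n.
        pair_graph G \<and> card (pverts G) = n \<and> min_degree_ge G (\<gamma> * real n) \<and>
        (\<exists>F. edge_disjoint_copies H G F \<and> real (card F) \<ge> \<epsilon> * real n ^ 2)
        \<longrightarrow> real (card (copies H G)) \<ge> \<delta> * real n ^ card (pverts H))"

definition removal_delta :: "real \<Rightarrow> 'a pair_pre_digraph \<Rightarrow> real \<Rightarrow> real" where
  "removal_delta \<epsilon> H \<gamma> = (GREATEST \<delta>. \<delta> \<in> {0..1} \<and> removal_bound \<epsilon> H \<gamma> \<delta>)"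

lemma removal_delta_is_maximum:
  "removal_delta \<epsilon> H \<gamma> \<in> {0..1} \<and> removal_bound \<epsilon> H \<gamma> (removal_delta \<epsilon> H \<gamma>)"
  "\<delta> \<in> {0..1} \<Longrightarrow> removal_bound \<epsilon> H \<gamma> \<delta> \<Longrightarrow> \<delta> \<le> removal_delta \<epsilon> H \<gamma>"
proof -
  define S where "S = {\<delta> \<in> {0..1}. removal_bound \<epsilon> H \<gamma> \<delta>}"
  have S0: "0 \<in> S" by (simp add: S_def removal_bound_def)
  have bdd: "bdd_above S" by (rule bdd_aboveI[of _ 1]) (simp add: S_def)
  have upper: "\<delta> \<le> Sup S" if "\<delta> \<in> S" for \<delta>
    using that bdd by (rule cSup_upper)
  have ne: "S \<noteq> {}" using S0 by blast
  have "Sup S \<le> 1" by (rule cSup_least[OF ne]) (simp add: S_def)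
  moreover have "0 \<le> Sup S" using upper[OF S0] .
  moreover have "removal_bound \<epsilon> H \<gamma> (Sup S)"
    unfolding removal_bound_def
  proof (intro allI impI)
    fix G :: "nat pair_pre_digraph" and n
    assume G: "pair_graph G \<and> card (pverts G) = n \<and> min_degree_ge G (\<gamma> * real n) \<and>
      (\<exists>F. edge_disjoint_copies H G F \<and> real (card F) \<ge> \<epsilon> * real n ^ 2)"
    let ?N = "real n ^ card (pverts H)" and ?c = "real (card (copies H G))"
    have le: "\<delta> * ?N \<le> ?c" if "\<delta> \<in> S" for \<delta>
    proof -
      have "removal_bound \<epsilon> H \<gamma> \<delta>" using that by (simp add: S_def)
      from this[unfolded removal_bound_def, rule_format, OF G] show ?thesis .
    qed
    show "Sup S * ?N \<le> ?c"
    proof (cases "?N = 0")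
      case False
      moreover have "?N \<ge> 0" by simp
      ultimately have pos: "?N > 0" by linarith
      have "Sup S \<le> ?c / ?N"
        by (rule cSup_least[OF ne]) (simp only: pos_le_divide_eq[OF pos] le)
      then show ?thesis by (simp only: pos_le_divide_eq[OF pos])
    next
      case True
      show ?thesis by (simp only: True mult_zero_right of_nat_0_le_iff)
    qed
  qed
  ultimately have "Sup S \<in> {0..1} \<and> removal_bound \<epsilon> H \<gamma> (Sup S)" by simp
  then have mem: "Sup S \<in> S" by (subst (2) S_def) (rule CollectI)
  have eq: "removal_delta \<epsilon> H \<gamma> = Sup S"
    unfolding removal_delta_def
  proof (rule Greatest_equality)
    show "Sup S \<in> {0..1} \<and> removal_bound \<epsilon> H \<gamma> (Sup S)"
      by fact
    show "\<delta> \<le> Sup S" if "\<delta> \<in> {0..1} \<and> removal_bound \<epsilon> H \<gamma> \<delta>" for \<delta>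
      by (rule upper) (unfold S_def, rule CollectI, rule that)
  qed
  show "removal_delta \<epsilon> H \<gamma> \<in> {0..1} \<and> removal_bound \<epsilon> H \<gamma> (removal_delta \<epsilon> H \<gamma>)"
    unfolding eq by fact
  show "\<delta> \<le> removal_delta \<epsilon> H \<gamma>" if "\<delta> \<in> {0..1}" "removal_bound \<epsilon> H \<gamma> \<delta>"
    unfolding eq by (rule upper) (unfold S_def, rule CollectI, rule conjI, fact+)
qed

text \<open>
  Since \<open>removal_delta\<close> is at most 1, the inequality \<open>removal_delta \<epsilon> H \<gamma> \<ge> \<mu> * \<epsilon>\<close> can only be asked
  for on a bounded range of \<open>\<epsilon>\<close>. When \<open>H\<close> has an edge, no graph on \<open>n \<ge> 1\<close> vertices contains
  \<open>\<epsilon> n\<^sup>2\<close> edge-disjoint copies of \<open>H\<close> if \<open>\<epsilon> > 1/2\<close>, so restricting to \<open>\<epsilon> \<le> 1\<close> discards only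
  vacuous values.
\<close>

definition linear_removal :: "'a pair_pre_digraph \<Rightarrow> real \<Rightarrow> bool" where
  "linear_removal H \<gamma> \<longleftrightarrow> (\<exists>\<mu>>0. \<forall>\<epsilon>. 0 < \<epsilon> \<and> \<epsilon> \<le> 1 \<longrightarrow> removal_delta \<epsilon> H \<gamma> \<ge> \<mu> * \<epsilon>)"

definition lin_rem_threshold :: "'a pair_pre_digraph \<Rightarrow> real" where
  "lin_rem_threshold H = Inf {\<gamma> \<in> {0..1}. linear_removal H \<gamma>}"

end

theory Submission
  imports Defs "HOL-Analysis.Convex" "HOL-Real_Asymp.Real_Asymp"
begin

text \<open>
  Upper bounds. Let \<open>f\<close> be one of the edge-disjoint copies of \<open>H\<close> in a host of minimum degree
  \<open>\<gamma> n\<close>. In most samples of boundedly many vertices, the sampled vertices and those of \<open>f\<close> have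
  sample degree above the threshold proportion. It then suffices to show that every such sample
  contains a homomorphic image of \<open>H\<close>, or else extends some edge of \<open>f\<close>, in the role of the critical
  edge, to a homomorphic image of \<open>H\<close>. Counting samples gives \<open>\<Omega>(n\<^sup>h)\<close> copies of \<open>H\<close>, or
  \<open>\<Omega>(n\<^bsup>h-2\<^esup>)\<close> copies through a fixed edge of each \<open>f\<close>. Above 1/2 the sample contains a triangle;
  above 1/3 two vertices of a triangle of \<open>f\<close> have a common neighbour; above 1/4 two consecutive
  vertices of a shortest odd cycle of \<open>f\<close> through the critical edge are joined by a walk of length 4.

  Lower bounds. \<open>N\<close> disjoint copies of \<open>H\<close> are attached to a bipartite graph of linear size in such a
  way that every copy of \<open>H\<close> uses at least two edges of the disjoint copies. There are then only
  \<open>O(n\<^bsup>h-2\<^esup>)\<close> copies, whereas linear removal would require a constant multiple of \<open>N n\<^bsup>h-2\<^esup>\<close>.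
\<close>

section \<open>Counting maps\<close>

text \<open>Linearity in \<open>\<epsilon>\<close> comes from counting separately around each of the
  \<open>\<epsilon> n^2\<close> edge-disjoint copies: the families of copies through an edge of each
  are disjoint, so their sizes add up. A sample yields only a homomorphic image of \<open>H\<close>,
  possibly with vertices identified, whereas copies are injective. A Cauchy-Schwarz blow-up
  separates the vertices, and non-injective maps are of lower order. Deleting a critical edge
  \<open>xy\<close> leaves a 2-colourable graph with \<open>x\<close> and \<open>y\<close> in the
  same class. Hence an even walk between the ends of a host edge can carry the rest of
  \<open>H\<close>: a common neighbour with a pendant edge is enough, and so is a walk of length 4
  when \<open>x\<close> and \<open>y\<close> have no common neighbour. In the lower bounds the
  constant is \<open>1 / s\<close>, where \<open>s\<close> independent sets suffice to give every
  label a neighbour among them. The label graph must not receive \<open>H\<close> even if one edge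
  of \<open>H\<close> is placed between two colour classes: \<open>s = 2\<close> achieves this when
  no edge is critical, \<open>s = 3\<close> excludes a triangle, and \<open>s = 4\<close> allows the
  label graph to stay bipartite after adding the edge.\<close>

lemma card_sq_le_card_fibre_pairs:
  assumes "finite Z" "finite Y" "r ` Z \<subseteq> Y"
  shows "real (card Z) ^ 2 \<le> real (card Y) * real (card {(s, s'). s \<in> Z \<and> s' \<in> Z \<and> r s = r s'})"
proof -
  define fib where "fib y = {s \<in> Z. r s = y}" for y
  have fin: "finite (fib y)" for y using assms(1) by (simp add: fib_def)
  have Z: "Z = (\<Union>y\<in>Y. fib y)" using assms(3) by (auto simp: fib_def)
  have cZ: "card Z = (\<Sum>y\<in>Y. card (fib y))"
    by (subst Z, rule card_UN_disjoint) (use assms fin in \<open>auto simp: fib_def\<close>)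
  have pairs: "{(s, s'). s \<in> Z \<and> s' \<in> Z \<and> r s = r s'} = (\<Union>y\<in>Y. fib y \<times> fib y)"
    using assms(3) by (auto simp: fib_def)
  have cp: "card {(s, s'). s \<in> Z \<and> s' \<in> Z \<and> r s = r s'} = (\<Sum>y\<in>Y. card (fib y) ^ 2)"
    by (subst pairs, subst card_UN_disjoint) (use assms fin in \<open>auto simp: fib_def power2_eq_square card_cartesian_product\<close>)
  have "(\<Sum>y\<in>Y. real (card (fib y)))\<^sup>2 \<le> (\<Sum>y\<in>Y. (real (card (fib y)))\<^sup>2) * card Y"
    by (rule sum_squared_le_sum_of_squares)
  then show ?thesis by (simp add: cZ cp mult.commute)
qed

text \<open>One vertex of the pattern is detached at a time: two tuples that agree off the coordinate
  \<open>\<phi> p\<close> combine to a tuple in which \<open>p\<close> has a coordinate of its own.\<close>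

lemma card_pattern_maps_ge:
  fixes V :: "'v set" and I :: "'i set" and P :: "'p set" and c :: real
  assumes fin: "finite V" "finite I" "finite P" and V: "V \<noteq> {}" and \<phi>: "\<phi> \<in> P \<rightarrow> I"
    and E: "\<And>p q. (p, q) \<in> E \<Longrightarrow> p \<in> P \<and> q \<in> P \<and> \<phi> p \<noteq> \<phi> q"
    and c: "0 \<le> c"
    and dense: "c * real (card V) ^ card I \<le>
      card {t \<in> I \<rightarrow>\<^sub>E V. (\<forall>(p, q)\<in>E. (t (\<phi> p), t (\<phi> q)) \<in> R) \<and> (\<forall>p\<in>P. t (\<phi> p) \<in> A p)}"
  shows "c ^ (2 ^ card P) * real (card V) ^ card P \<le>
      card {g \<in> P \<rightarrow>\<^sub>E V. (\<forall>(p, q)\<in>E. (g p, g q) \<in> R) \<and> (\<forall>p\<in>P. g p \<in> A p)}"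
proof -
  define n where "n = card V"
  have n: "n > 0" using fin V by (simp add: n_def card_gt_0_iff)
  define D where "D P' = (Inl ` I \<union> Inr ` P' :: ('i + 'p) set)" for P'
  \<comment> \<open>\<open>Inl\<close> coordinates hold the original tuple and \<open>Inr\<close>
    coordinates the detached values; \<open>val P' s p\<close> is the value that \<open>p\<close>
    currently uses.\<close>
  define val where "val P' s p = (if p \<in> P' then s (Inr p) else s (Inl (\<phi> p)))"
    for P' and s :: "'i + 'p \<Rightarrow> 'v" and p
  define Z where "Z P' = {s \<in> D P' \<rightarrow>\<^sub>E V. (\<forall>(p, q)\<in>E. (val P' s p, val P' s q) \<in> R) \<and>
      (\<forall>p\<in>P. val P' s p \<in> A p)}" for P'
  have finD: "finite (D P')" if "P' \<subseteq> P" for P'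
    using that fin by (auto simp: D_def intro: finite_subset)
  have cardD: "card (D P') = card I + card P'" if "P' \<subseteq> P" for P'
  proof -
    have "finite P'" using that fin finite_subset by blast
    then show ?thesis unfolding D_def using fin
      by (subst card_Un_disjoint) (auto simp: card_image)
  qed
  have finZ: "finite (Z P')" if "P' \<subseteq> P" for P'
    unfolding Z_def using finD[OF that] fin by (intro finite_Collect_conjI disjI1) (simp add: finite_PiE)
  have main: "c ^ (2 ^ card P') * real n ^ (card I + card P') \<le> card (Z P')" if "P' \<subseteq> P" for P'
    using finite_subset[OF that fin(3)] that
  proof (induction P' rule: finite_induct)
    case empty
    let ?T = "{t \<in> I \<rightarrow>\<^sub>E V. (\<forall>(p, q)\<in>E. (t (\<phi> p), t (\<phi> q)) \<in> R) \<and> (\<forall>p\<in>P. t (\<phi> p) \<in> A p)}"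
    let ?F = "\<lambda>t :: 'i \<Rightarrow> 'v. (\<lambda>z. case z of Inl i \<Rightarrow> t i | Inr (p::'p) \<Rightarrow> undefined)"
    have "inj_on ?F ?T"
    proof (rule inj_onI)
      fix s t assume "?F s = ?F t"
      then have "?F s (Inl i) = ?F t (Inl i)" for i by simp
      then show "s = t" by auto
    qed
    moreover have "?F ` ?T \<subseteq> Z {}"
      by (fastforce simp: Z_def D_def val_def PiE_def extensional_def split: sum.splits)
    ultimately have "card ?T \<le> card (Z {})" using finZ[of "{}"] by (intro card_inj_on_le) auto
    then show ?case using dense by (simp add: n_def)
  next
    case (insert p P')
    let ?k = "Inl (\<phi> p) :: 'i + 'p"
    have P': "P' \<subseteq> P" and p: "p \<in> P" using insert by auto
    have k: "?k \<in> D P'" using \<phi> p by (auto simp: D_def)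
    define r where "r s = restrict s (D P' - {?k})" for s :: "'i + 'p \<Rightarrow> 'v"
    let ?pairs = "{(s, s'). s \<in> Z P' \<and> s' \<in> Z P' \<and> r s = r s'}"
    let ?join = "\<lambda>(s, s'). s(Inr p := s' ?k)"
    have pD: "Inr p \<notin> D P'" using insert by (auto simp: D_def)
    have Dins: "D (insert p P') = insert (Inr p) (D P')" by (auto simp: D_def)
    have agree: "s z = s' z" if "(s, s') \<in> ?pairs" "z \<noteq> ?k" for s s' z
    proof (cases "z \<in> D P'")
      case True
      have "r s z = r s' z" using that by auto
      then show ?thesis using True that by (simp add: r_def)
    next
      case False
      have "s \<in> D P' \<rightarrow>\<^sub>E V" "s' \<in> D P' \<rightarrow>\<^sub>E V" using that by (auto simp: Z_def)
      then show ?thesis using False by (metis PiE_arb)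
    qed
    have "inj_on ?join ?pairs"
    proof (rule inj_onI)
      fix a b assume a: "a \<in> ?pairs" and b: "b \<in> ?pairs" and eq: "?join a = ?join b"
      obtain s s' where a': "a = (s, s')" by (cases a)
      obtain u u' where b': "b = (u, u')" by (cases b)
      have eq': "(s(Inr p := s' ?k)) z = (u(Inr p := u' ?k)) z" for z using eq by (simp add: a' b')
      have su: "s = u"
      proof
        fix z
        show "s z = u z"
        proof (cases "z = Inr p")
          case True
          have "s \<in> D P' \<rightarrow>\<^sub>E V" "u \<in> D P' \<rightarrow>\<^sub>E V" using a b by (auto simp: a' b' Z_def)
          then show ?thesis using True pD by (metis PiE_arb)
        next
          case False
          then show ?thesis using eq'[of z] by simp
        qed
      qed
      have "s' = u'"
      proof
        fix z
        show "s' z = u' z"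
        proof (cases "z = ?k")
          case True
          then show ?thesis using eq'[of "Inr p"] by simp
        next
          case False
          then show ?thesis using agree[OF a[unfolded a'] False] agree[OF b[unfolded b'] False] su by simp
        qed
      qed
      then show "a = b" using su by (simp add: a' b')
    qed
    moreover have "?join ` ?pairs \<subseteq> Z (insert p P')"
    proof clarify
      fix s s' assume s: "s \<in> Z P'" and s': "s' \<in> Z P'" and rr: "r s = r s'"
      have pr: "(s, s') \<in> ?pairs" using s s' rr by simp
      define w where "w = s(Inr p := s' ?k)"
      have s'k: "s' ?k \<in> V" using s' k by (auto simp: Z_def)
      have w1: "w \<in> D (insert p P') \<rightarrow>\<^sub>E V"
      proof (rule PiE_I)
        have sD: "s \<in> D P' \<rightarrow>\<^sub>E V" using s by (auto simp: Z_def)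
        show "w z \<in> V" if "z \<in> D (insert p P')" for z
          using that s'k PiE_mem[OF sD] by (auto simp: Dins w_def)
        show "w z = undefined" if "z \<notin> D (insert p P')" for z
          using that PiE_arb[OF sD] by (auto simp: Dins w_def)
      qed
      have vp: "val (insert p P') w p = val P' s' p"
        using insert by (simp add: val_def w_def)
      have vq: "val (insert p P') w q = val P' s q" if "q \<noteq> p" for q
        using that by (simp add: val_def w_def)
      have vq': "val P' s q = val P' s' q" if "\<phi> q \<noteq> \<phi> p" for q
        using that agree[OF pr] by (simp add: val_def)
      \<comment> \<open>An arc at \<open>p\<close> has its other end at a pattern vertex with a
        different \<open>\<phi>\<close>, where \<open>s\<close> and \<open>s'\<close> agree, so it
        is inherited from \<open>s'\<close>; all other arcs come from \<open>s\<close>.\<close>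
      have "(val (insert p P') w a, val (insert p P') w b) \<in> R" if ab: "(a, b) \<in> E" for a b
      proof -
        have ne: "\<phi> a \<noteq> \<phi> b" using E ab by blast
        have Rs: "(val P' s a, val P' s b) \<in> R" "(val P' s' a, val P' s' b) \<in> R"
          using s s' ab by (auto simp: Z_def)
        show ?thesis
        proof (cases "a = p")
          case True
          then have "b \<noteq> p" using ne by auto
          then show ?thesis using True vp vq vq'[of b] ne Rs by simp
        next
          case False
          then show ?thesis using vp vq vq'[of a] ne Rs by (cases "b = p") auto
        qed
      qed
      moreover have "val (insert p P') w q \<in> A q" if "q \<in> P" for q
        using that s s' vp vq[of q] by (cases "q = p") (auto simp: Z_def)
      ultimately show "s(Inr p := s' ?k) \<in> Z (insert p P')"
        using w1 unfolding w_def Z_def by blast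
    qed
    ultimately have le: "card ?pairs \<le> card (Z (insert p P'))"
      using finZ[OF insert.prems] by (rule card_inj_on_le)
    have cY: "card ((D P' - {?k}) \<rightarrow>\<^sub>E V) = n ^ (card I + card P' - 1)"
      using finD[OF P'] cardD[OF P'] k by (simp add: card_PiE n_def)
    have fY: "finite ((D P' - {?k}) \<rightarrow>\<^sub>E V)"
      using finD[OF P'] fin by (auto intro: finite_PiE)
    have rY: "r ` Z P' \<subseteq> (D P' - {?k}) \<rightarrow>\<^sub>E V"
    proof clarify
    fix s assume "s \<in> Z P'"
    then show "r s \<in> (D P' - {?k}) \<rightarrow>\<^sub>E V" unfolding r_def restrict_PiE_iff by (auto simp: Z_def)
  qed
    \<comment> \<open>The fibres are indexed by tuples without the coordinate
      \<open>\<phi> p\<close>, so Cauchy-Schwarz squares the density; this is the source of the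
      exponent \<open>2 ^ card P\<close>.\<close>
    have CS: "real (card (Z P')) ^ 2 \<le> real n ^ (card I + card P' - 1) * real (card (Z (insert p P')))"
    proof -
      have "real (card (Z P')) ^ 2 \<le> real n ^ (card I + card P' - 1) * real (card ?pairs)"
        using card_sq_le_card_fibre_pairs[OF finZ[OF P'] fY rY] by (simp add: cY)
      also have "\<dots> \<le> real n ^ (card I + card P' - 1) * real (card (Z (insert p P')))"
        using le by (intro mult_left_mono) auto
      finally show ?thesis .
    qed
    have I1: "card I + card P' > 0" using cardD[OF P'] k finD[OF P'] by (metis card_gt_0_iff empty_iff)
    define l where "l = card I + card P' - 1"
    have l: "card I + card P' = Suc l" using I1 by (simp add: l_def)
    have "(c ^ (2 ^ card P') * real n ^ Suc l) ^ 2 \<le> real (card (Z P')) ^ 2"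
      using insert.IH[OF P'] c by (intro power_mono) (simp_all add: l)
    then have "(c ^ (2 ^ card P') * real n ^ Suc l) ^ 2 \<le> real n ^ l * real (card (Z (insert p P')))"
      using CS by (simp add: l)
    moreover have "(c ^ (2 ^ card P') * real n ^ Suc l) ^ 2
        = real n ^ l * (c ^ (2 ^ Suc (card P')) * real n ^ Suc (Suc l))"
      by (simp add: power2_eq_square power_add mult_2 algebra_simps)
    ultimately have "c ^ (2 ^ Suc (card P')) * real n ^ Suc (Suc l) \<le> real (card (Z (insert p P')))"
      using n by (simp del: power_Suc)
    moreover have "card I + card (insert p P') = Suc (Suc l)" using insert l by simp
    moreover have "card (insert p P') = Suc (card P')" using insert by simp
    ultimately show ?case by (simp only:)
  qed
  let ?G = "{g \<in> P \<rightarrow>\<^sub>E V. (\<forall>(p, q)\<in>E. (g p, g q) \<in> R) \<and> (\<forall>p\<in>P. g p \<in> A p)}"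
  have finG: "finite ?G" using fin by (intro finite_Collect_conjI disjI1) (simp add: finite_PiE)
  \<comment> \<open>With every pattern vertex detached, the coordinates in \<open>I\<close> are
    unconstrained. They account for a factor of at most \<open>n ^ card I\<close>, which
    cancels.\<close>
  let ?split = "\<lambda>s :: 'i + 'p \<Rightarrow> 'v. (\<lambda>i\<in>I. s (Inl i), \<lambda>p\<in>P. s (Inr p))"
  have "inj_on ?split (Z P)"
  proof (rule inj_onI)
    fix s t assume s: "s \<in> Z P" and t: "t \<in> Z P" and eq: "?split s = ?split t"
    have 1: "s (Inl i) = t (Inl i)" if "i \<in> I" for i
    proof -
      have "(\<lambda>i\<in>I. s (Inl i)) i = (\<lambda>i\<in>I. t (Inl i)) i" using eq by simp
      then show ?thesis using that by simp
    qed
    have 2: "s (Inr i) = t (Inr i)" if "i \<in> P" for i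
    proof -
      have "(\<lambda>p\<in>P. s (Inr p)) i = (\<lambda>p\<in>P. t (Inr p)) i" using eq by simp
      then show ?thesis using that by simp
    qed
    have "s z = t z" if "z \<in> D P" for z using that 1 2 by (auto simp: D_def)
    then show "s = t" using s t unfolding Z_def by (auto intro: PiE_ext)
  qed
  moreover have "?split ` Z P \<subseteq> (I \<rightarrow>\<^sub>E V) \<times> ?G"
  proof (rule image_subsetI)
    fix s assume s: "s \<in> Z P"
    have "(\<lambda>i\<in>I. s (Inl i)) \<in> I \<rightarrow>\<^sub>E V" "(\<lambda>p\<in>P. s (Inr p)) \<in> P \<rightarrow>\<^sub>E V"
      using s by (auto simp: Z_def D_def)
    moreover have "val P s p = s (Inr p)" if "p \<in> P" for p using that by (simp add: val_def)
    ultimately show "?split s \<in> (I \<rightarrow>\<^sub>E V) \<times> ?G"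
      using s E unfolding Z_def by (fastforce)
  qed
  ultimately have "card (Z P) \<le> card ((I \<rightarrow>\<^sub>E V) \<times> ?G)"
    using fin finG by (intro card_inj_on_le) (auto intro: finite_PiE)
  also have "\<dots> = n ^ card I * card ?G"
    using fin by (simp add: card_cartesian_product card_PiE n_def)
  finally have "real (card (Z P)) \<le> real (n ^ card I * card ?G)" by (simp only: of_nat_le_iff)
  then have "real (card (Z P)) \<le> real n ^ card I * real (card ?G)" by (simp only: of_nat_mult of_nat_power)
  with main[of P] have "c ^ (2 ^ card P) * real n ^ (card I + card P) \<le> real n ^ card I * real (card ?G)"
    by simp
  then have "real n ^ card I * (c ^ (2 ^ card P) * real n ^ card P) \<le> real n ^ card I * real (card ?G)"
    by (simp add: power_add algebra_simps)
  then show ?thesis using n by (simp add: n_def)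
qed

section \<open>Degenerate maps\<close>

lemma card_PiE_determined_coordinate:
  assumes "finite V" "finite P" "p \<in> P"
  shows "card {g \<in> P \<rightarrow>\<^sub>E V. g p = \<kappa> (restrict g (P - {p}))} \<le> card V ^ (card P - 1)"
proof -
  let ?S = "{g \<in> P \<rightarrow>\<^sub>E V. g p = \<kappa> (restrict g (P - {p}))}"
  have "inj_on (\<lambda>g. restrict g (P - {p})) ?S"
  proof (rule inj_onI)
    fix g h assume g: "g \<in> ?S" and h: "h \<in> ?S"
      and eq: "restrict g (P - {p}) = restrict h (P - {p})"
    have "g z = h z" if "z \<in> P" for z
    proof (cases "z = p")
      case True
      then show ?thesis using g h eq by auto
    next
      case False
      then have "restrict g (P - {p}) z = restrict h (P - {p}) z" using eq by simp
      then show ?thesis using that False by simp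
    qed
    then show "g = h" using g h by (auto intro: PiE_ext)
  qed
  then have "card ?S \<le> card ((P - {p}) \<rightarrow>\<^sub>E V)"
  proof (rule card_inj_on_le)
    show "(\<lambda>g. restrict g (P - {p})) ` ?S \<subseteq> (P - {p}) \<rightarrow>\<^sub>E V"
    proof clarify
      fix g assume "g \<in> P \<rightarrow>\<^sub>E V"
      then show "restrict g (P - {p}) \<in> (P - {p}) \<rightarrow>\<^sub>E V" unfolding restrict_PiE_iff by auto
    qed
    show "finite ((P - {p}) \<rightarrow>\<^sub>E V)" using assms by (intro finite_PiE) auto
  qed
  then show ?thesis using assms by (simp add: card_PiE)
qed

text \<open>A failure makes one coordinate equal to another one or to an element of
  \<open>B\<close>, hence a function of the remaining coordinates. \<open>K\<close> encodes the two
  sources of that value as a sum type.\<close>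

lemma card_non_injective_maps_le:
  assumes "finite V" "finite P" "finite B"
  shows "card {g \<in> P \<rightarrow>\<^sub>E V. \<not> (inj_on g P \<and> g ` P \<inter> B = {})}
    \<le> (card P + card B) * card P * card V ^ (card P - 1)"
proof -
  define K where "K z r = (case z of Inl q \<Rightarrow> r q | Inr b \<Rightarrow> b)" for z :: "'b + 'a" and r :: "'b \<Rightarrow> 'a"
  let ?Z = "Inl ` P \<union> Inr ` B :: ('b + 'a) set"
  let ?S = "\<lambda>(z, p). {g \<in> P \<rightarrow>\<^sub>E V. g p = K z (restrict g (P - {p}))}"
  have sub: "{g \<in> P \<rightarrow>\<^sub>E V. \<not> (inj_on g P \<and> g ` P \<inter> B = {})} \<subseteq> (\<Union>a\<in>?Z \<times> P. ?S a)"
  proof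
    fix g assume "g \<in> {g \<in> P \<rightarrow>\<^sub>E V. \<not> (inj_on g P \<and> g ` P \<inter> B = {})}"
    then have g: "g \<in> P \<rightarrow>\<^sub>E V" and "\<not> inj_on g P \<or> g ` P \<inter> B \<noteq> {}" by auto
    then consider p q where "p \<in> P" "q \<in> P" "p \<noteq> q" "g p = g q" | p where "p \<in> P" "g p \<in> B"
      by (auto simp: inj_on_def)
    then show "g \<in> (\<Union>a\<in>?Z \<times> P. ?S a)"
    proof cases
      case (1 p q)
      then have "g \<in> ?S (Inl q, p)" using g by (simp add: K_def)
      then show ?thesis using 1 by blast
    next
      case (2 p)
      then have "g \<in> ?S (Inr (g p), p)" using g by (simp add: K_def)
      then show ?thesis using 2 by blast
    qed
  qed
  have fin: "finite (\<Union>a\<in>?Z \<times> P. ?S a)"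
  proof (rule finite_UN_I)
    show "finite (?Z \<times> P)" using assms by simp
    have "finite (P \<rightarrow>\<^sub>E V)" using assms by (intro finite_PiE) auto
    then show "finite (?S a)" for a by (auto split: prod.split)
  qed
  have "card {g \<in> P \<rightarrow>\<^sub>E V. \<not> (inj_on g P \<and> g ` P \<inter> B = {})} \<le> card (\<Union>a\<in>?Z \<times> P. ?S a)"
    by (rule card_mono[OF fin sub])
  also have "\<dots> \<le> (\<Sum>a\<in>?Z \<times> P. card (?S a))"
    using assms by (intro card_UN_le) auto
  also have "\<dots> \<le> (\<Sum>a\<in>?Z \<times> P. card V ^ (card P - 1))"
    using assms by (intro sum_mono) (auto simp del: One_nat_def intro: card_PiE_determined_coordinate)
  also have "\<dots> = (card P + card B) * card P * card V ^ (card P - 1)"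
  proof -
    have "card ?Z = card P + card B"
      using assms by (subst card_Un_disjoint) (auto simp: card_image)
    then show ?thesis by (simp add: card_cartesian_product)
  qed
  finally show ?thesis .
qed

section \<open>A Chernoff bound for uniform maps\<close>

lemma exp_minus_le_quadratic:
  fixes l :: real
  assumes "l \<ge> 0"
  shows "exp (- l) \<le> 1 - l + l\<^sup>2 / 2"
proof -
  have "(1 + l + l\<^sup>2 / 2) * (1 - l + l\<^sup>2 / 2) = 1 + l ^ 4 / 4"
    by (simp add: algebra_simps power2_eq_square power4_eq_xxxx)
  moreover have "l ^ 4 / 4 \<ge> 0" by simp
  ultimately have "1 \<le> (1 + l + l\<^sup>2 / 2) * (1 - l + l\<^sup>2 / 2)" by linarith
  also have "\<dots> \<le> exp l * (1 - l + l\<^sup>2 / 2)"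
  proof (rule mult_right_mono)
    show "1 + l + l\<^sup>2 / 2 \<le> exp l" using exp_lower_Taylor_quadratic[OF assms] .
    have "1 - l + l\<^sup>2 / 2 = ((1 - l)\<^sup>2 + 1) / 2" by (simp add: power2_eq_square algebra_simps)
    moreover have "0 \<le> ((1 - l)\<^sup>2 + 1) / 2" by simp
    ultimately show "0 \<le> 1 - l + l\<^sup>2 / 2" by linarith
  qed
  finally show ?thesis by (simp add: exp_minus field_simps)
qed

text \<open>Weight each map by a factor \<open>exp (- l)\<close> for every coordinate that lands in
  \<open>A\<close>. The total weight factors over the coordinates, while a map with few hits has
  weight at least \<open>exp (- l * \<theta>)\<close>.\<close>

lemma card_maps_few_hits_le:
  fixes \<gamma> l \<theta> :: real
  assumes "finite V" "finite J" "A \<subseteq> V" "\<gamma> * real (card V) \<le> real (card A)" "0 \<le> l" "\<gamma> \<le> 1" "0 \<le> \<gamma>"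
  shows "real (card {t \<in> J \<rightarrow>\<^sub>E V. real (card {j \<in> J. t j \<in> A}) \<le> \<theta>})
    \<le> real (card V) ^ card J * exp (l * \<theta> - (\<gamma> * l - l\<^sup>2 / 2) * real (card J))"
proof -
  let ?B = "{t \<in> J \<rightarrow>\<^sub>E V. real (card {j \<in> J. t j \<in> A}) \<le> \<theta>}"
  let ?w = "\<lambda>v. if v \<in> A then exp (- l) else 1"
  have finA: "finite A" using assms finite_subset by blast
  have w: "(\<Prod>j\<in>J. ?w (t j)) = exp (- l * real (card {j \<in> J. t j \<in> A}))" for t
  proof -
    have "(\<Prod>j\<in>J. ?w (t j)) = (\<Prod>j\<in>{j \<in> J. t j \<in> A}. exp (- l))"
      using assms(2) by (simp only: prod.inter_filter)
    then show ?thesis by (simp flip: exp_of_nat_mult add: mult.commute)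
  qed
  have "real (card ?B) * exp (- l * \<theta>) = (\<Sum>t\<in>?B. exp (- l * \<theta>))" by simp
  also have "\<dots> \<le> (\<Sum>t\<in>?B. \<Prod>j\<in>J. ?w (t j))"
    unfolding w using assms(5) by (intro sum_mono) (auto intro: mult_left_mono)
  also have "\<dots> \<le> (\<Sum>t\<in>J \<rightarrow>\<^sub>E V. \<Prod>j\<in>J. ?w (t j))"
    using assms by (intro sum_mono2) (auto intro: finite_PiE prod_nonneg)
  also have "\<dots> = (\<Prod>j\<in>J. \<Sum>v\<in>V. ?w v)"
    using assms by (subst prod_sum_PiE) auto
  also have "\<dots> = (\<Sum>v\<in>V. ?w v) ^ card J" by simp
  also have "(\<Sum>v\<in>V. ?w v) = real (card A) * exp (- l) + real (card (V - A))"
  proof -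
    have "(\<Sum>v\<in>V. ?w v) = (\<Sum>v\<in>A. ?w v) + (\<Sum>v\<in>V - A. ?w v)"
      using assms by (subst sum.subset_diff[of A V]) auto
    then show ?thesis by simp
  qed
  also have "(real (card A) * exp (- l) + real (card (V - A))) ^ card J
      \<le> (real (card V) * exp (- (\<gamma> * l - l\<^sup>2 / 2))) ^ card J"
  proof (rule power_mono)
    have "real (card (V - A)) = real (card V) - real (card A)"
      using assms finA by (simp add: card_Diff_subset of_nat_diff card_mono)
    then have "real (card A) * exp (- l) + real (card (V - A)) = real (card V) - real (card A) * (1 - exp (- l))"
      by (simp add: algebra_simps)
    also have "\<dots> \<le> real (card V) - \<gamma> * real (card V) * (1 - exp (- l))"
      using assms by (intro diff_left_mono mult_right_mono) auto
    also have "\<dots> = real (card V) * (1 - \<gamma> + \<gamma> * exp (- l))" by (simp add: algebra_simps)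
    also have "\<dots> \<le> real (card V) * exp (- (\<gamma> * l - l\<^sup>2 / 2))"
    proof (rule mult_left_mono)
      have "\<gamma> * exp (- l) \<le> \<gamma> * (1 - l + l\<^sup>2 / 2)"
        using exp_minus_le_quadratic[OF assms(5)] assms by (intro mult_left_mono) auto
      moreover have "\<gamma> * (l\<^sup>2 / 2) \<le> 1 * (l\<^sup>2 / 2)" using assms by (intro mult_right_mono) auto
      ultimately have "1 - \<gamma> + \<gamma> * exp (- l) \<le> 1 + (- (\<gamma> * l - l\<^sup>2 / 2))"
        by (simp add: algebra_simps)
      also have "\<dots> \<le> exp (- (\<gamma> * l - l\<^sup>2 / 2))" by (rule exp_ge_add_one_self)
      finally show "1 - \<gamma> + \<gamma> * exp (- l) \<le> exp (- (\<gamma> * l - l\<^sup>2 / 2))" .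
    qed simp
    finally show "real (card A) * exp (- l) + real (card (V - A)) \<le> real (card V) * exp (- (\<gamma> * l - l\<^sup>2 / 2))" .
  qed auto
  also have "\<dots> = real (card V) ^ card J * exp (- (\<gamma> * l - l\<^sup>2 / 2) * real (card J))"
    by (simp add: power_mult_distrib flip: exp_of_nat_mult add: mult.commute)
  finally have le: "real (card ?B) * exp (- l * \<theta>)
      \<le> real (card V) ^ card J * exp (- (\<gamma> * l - l\<^sup>2 / 2) * real (card J))" .
  have "real (card ?B) = real (card ?B) * exp (- l * \<theta>) * exp (l * \<theta>)"
    by (simp add: exp_minus)
  also have "\<dots> \<le> real (card V) ^ card J * exp (- (\<gamma> * l - l\<^sup>2 / 2) * real (card J)) * exp (l * \<theta>)"
    using le by (intro mult_right_mono) auto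
  also have "\<dots> = real (card V) ^ card J * exp (l * \<theta> - (\<gamma> * l - l\<^sup>2 / 2) * real (card J))"
  proof -
    have "- (\<gamma> * l - l\<^sup>2 / 2) * real (card J) + l * \<theta> = l * \<theta> - (\<gamma> * l - l\<^sup>2 / 2) * real (card J)"
      by (simp add: algebra_simps)
    then show ?thesis by (metis exp_add mult.assoc)
  qed
  finally show ?thesis .
qed

section \<open>Graphs of minimum degree above a quarter\<close>

lemma not_two_disjoint_halves:
  assumes "finite X" "A \<subseteq> X" "B \<subseteq> X" "A \<inter> B = {}" "2 * card X \<le> m" "m < 4 * card A" "m < 4 * card B"
  shows False
proof -
  have "card A + card B = card (A \<union> B)"
    using assms by (intro card_Un_disjoint[symmetric]) (auto intro: finite_subset)
  also have "\<dots> \<le> card X" using assms by (intro card_mono) auto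
  finally show False using assms by linarith
qed

text \<open>The graph spanned by a sample, with the threshold \<open>1 / 4\<close> cleared of
  fractions so that the pigeonhole arguments stay in \<open>nat\<close>.\<close>

locale quarter_dense =
  fixes M :: "'v set" and Q :: "'v rel"
  assumes finite_M: "finite M" and Q_sub: "Q \<subseteq> M \<times> M" and sym_Q: "sym Q" and irrefl_Q: "irrefl Q"
    and degree: "v \<in> M \<Longrightarrow> card M < 4 * card (Q `` {v})"
begin

lemma Q_sym: "(a, b) \<in> Q \<Longrightarrow> (b, a) \<in> Q"
  using sym_Q by (rule symD)

lemma nbr_sub: "Q `` A \<subseteq> M" using Q_sub by auto

lemma ex_nbr: "v \<in> M \<Longrightarrow> \<exists>w. (v, w) \<in> Q"
  using degree[of v] by (cases "Q `` {v} = {}") auto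

lemma closed_walk_extend:
  assumes "(a, a) \<in> Q ^^ l" "l > 0"
  shows "(a, a) \<in> Q ^^ (l + 2 * j)"
proof (induction j)
  case 0
  then show ?case using assms by simp
next
  case (Suc j)
  obtain b where "(a, b) \<in> Q" using assms by (cases l) (auto intro: Q_sym)
  then have "(a, a) \<in> Q ^^ 2" using Q_sym by (auto simp: numeral_2_eq_2)
  then have "(a, a) \<in> Q ^^ ((l + 2 * j) + 2)" using Suc unfolding relpow_add by blast
  then show ?case by simp
qed

lemma not_four_disjoint:
  assumes "A \<subseteq> M" "B \<subseteq> M" "C \<subseteq> M" "D \<subseteq> M"
    and "A \<inter> B = {}" "A \<inter> C = {}" "A \<inter> D = {}" "B \<inter> C = {}" "B \<inter> D = {}" "C \<inter> D = {}"
    and "card M < 4 * card A" "card M < 4 * card B" "card M < 4 * card C" "card M < 4 * card D"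
  shows False
proof -
  have fin: "finite A" "finite B" "finite C" "finite D"
    using assms finite_M by (auto intro: finite_subset)
  have "card A + card B + card C + card D = card (A \<union> B \<union> C \<union> D)"
    using fin assms by (subst card_Un_disjoint, auto)+
  also have "\<dots> \<le> card M" using assms finite_M by (intro card_mono) auto
  finally show False using assms by linarith
qed

text \<open>Fix an edge \<open>ab\<close>. The second neighbourhoods \<open>Ta\<close> and
  \<open>Tb\<close> are disjoint and independent, since otherwise there is a closed walk of length
  5. A vertex of the rest \<open>R\<close> has no common neighbour with \<open>a\<close> or
  \<open>b\<close>, so an edge inside \<open>R\<close> would produce four disjoint neighbourhoods. A
  vertex of \<open>R\<close> adjacent to both \<open>Ta\<close> and \<open>Tb\<close> would close a
  walk of length 7 through \<open>ab\<close>, so each vertex of \<open>R\<close> can be put on a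
  side.\<close>

lemma bipartite_if_no_short_odd_closed_walk:
  assumes no: "\<And>a. (a, a) \<notin> Q ^^ 3" "\<And>a. (a, a) \<notin> Q ^^ 5" "\<And>a. (a, a) \<notin> Q ^^ 7" and "M \<noteq> {}"
  shows "\<exists>P \<subseteq> M. \<forall>a b. (a, b) \<in> Q \<longrightarrow> (a \<in> P) \<noteq> (b \<in> P)"
proof -
  have tri: False if "(a, b) \<in> Q" "(b, c) \<in> Q" "(c, a) \<in> Q" for a b c
    using that no(1)[of a] by (auto simp: eval_nat_numeral)
  have pent: False if "(a, b) \<in> Q" "(b, c) \<in> Q" "(c, d) \<in> Q" "(d, e) \<in> Q" "(e, a) \<in> Q" for a b c d e
    using that no(2)[of a] by (auto simp: eval_nat_numeral)
  have hept: False if "(a, b) \<in> Q" "(b, c) \<in> Q" "(c, d) \<in> Q" "(d, e) \<in> Q" "(e, f) \<in> Q" "(f, g) \<in> Q" "(g, a) \<in> Q"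
    for a b c d e f g
  proof -
    have "(a, a) \<in> Q ^^ 7" using that by (simp add: eval_nat_numeral) (meson relcompI)
    then show False using no(3) by blast
  qed
  obtain a b where ab: "(a, b) \<in> Q" using \<open>M \<noteq> {}\<close> ex_nbr by blast
  define Ta where "Ta = Q `` (Q `` {a})"
  define Tb where "Tb = Q `` (Q `` {b})"
  define R where "R = M - (Ta \<union> Tb)"
  have TaE: "\<exists>d. (c, d) \<in> Q \<and> (d, a) \<in> Q" if "c \<in> Ta" for c using that Q_sym by (auto simp: Ta_def)
  have TbE: "\<exists>d. (c, d) \<in> Q \<and> (d, b) \<in> Q" if "c \<in> Tb" for c using that Q_sym by (auto simp: Tb_def)
  have disj: "Ta \<inter> Tb = {}"
    using TaE TbE ab pent Q_sym by blast
  have indep_a: "\<not> (c \<in> Ta \<and> d \<in> Ta)" if "(c, d) \<in> Q" for c d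
    using that TaE[of c] TaE[of d] pent Q_sym by blast
  have indep_b: "\<not> (c \<in> Tb \<and> d \<in> Tb)" if "(c, d) \<in> Q" for c d
    using that TbE[of c] TbE[of d] pent Q_sym by blast
  have indep_R: "\<not> (c \<in> R \<and> d \<in> R)" if cd: "(c, d) \<in> Q" for c d
  proof
    assume R: "c \<in> R \<and> d \<in> R"
    have far: "Q `` {z} \<inter> Q `` {a} = {}" "Q `` {z} \<inter> Q `` {b} = {}" if "z \<in> R" for z
      using that Q_sym by (auto simp: R_def Ta_def Tb_def)
    have in_M: "a \<in> M" "b \<in> M" "c \<in> M" "d \<in> M" using ab cd Q_sub by auto
    show False
    proof (rule not_four_disjoint[of "Q `` {a}" "Q `` {b}" "Q `` {c}" "Q `` {d}"])
      show "Q `` {a} \<inter> Q `` {b} = {}" using ab tri Q_sym by blast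
      show "Q `` {c} \<inter> Q `` {d} = {}" using cd tri Q_sym by blast
    qed (use R far in_M degree nbr_sub in blast)+
  qed
  define P where "P = Ta \<union> {c \<in> R. Q `` {c} \<inter> Ta = {}}"
  have "(c \<in> P) \<noteq> (d \<in> P)" if cd: "(c, d) \<in> Q" for c d
  proof -
    have R_one_side: "Q `` {z} \<inter> Ta = {} \<or> Q `` {z} \<inter> Tb = {}" for z
      using TaE TbE ab hept Q_sym by blast
    have dc: "(d, c) \<in> Q" using cd by (rule Q_sym)
    have "c \<in> M" "d \<in> M" using cd Q_sub by auto
    then consider "c \<in> Ta" "d \<in> Tb" | "c \<in> Tb" "d \<in> Ta" | "c \<in> R" "d \<in> Ta" | "c \<in> R" "d \<in> Tb"
      | "c \<in> Ta" "d \<in> R" | "c \<in> Tb" "d \<in> R"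
      using indep_a[OF cd] indep_b[OF cd] indep_R[OF cd] by (auto simp: R_def)
    then show ?thesis
      by cases (use cd dc R_one_side disj in \<open>fastforce simp: P_def R_def\<close>)+
  qed
  moreover have "P \<subseteq> M" using nbr_sub by (auto simp: P_def R_def Ta_def)
  ultimately show ?thesis by blast
qed

text \<open>The neighbourhoods of the positions \<open>j\<close>, \<open>j + 1\<close>,
  \<open>j + 4\<close> are pairwise disjoint: two of these are adjacent, and the other pairs are
  three steps apart around the walk. If \<open>S\<close> missed all three, there would be four
  disjoint sets above a quarter. So each of these seven triples contains a hit; every position lies
  in three of them, and \<open>7 / 3\<close> rounds up to \<open>3\<close>.\<close>

lemma seven_walk_meets_second_nbrs:
  assumes no: "\<And>a. (a, a) \<notin> Q ^^ 3" "\<And>a. (a, a) \<notin> Q ^^ 5"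
    and a: "\<And>j. (a j, a (Suc j)) \<in> Q" "\<And>j. a (j + 7) = a j"
    and S: "S \<subseteq> M" "card M < 4 * card S"
  shows "3 \<le> (\<Sum>j<7. of_bool (a j \<in> Q `` S) :: nat)"
proof -
  have tri: False if "(a, b) \<in> Q" "(b, c) \<in> Q" "(c, a) \<in> Q" for a b c
    using that no(1)[of a] by (auto simp: eval_nat_numeral)
  have pent: False if "(a, b) \<in> Q" "(b, c) \<in> Q" "(c, d) \<in> Q" "(d, e) \<in> Q" "(e, a) \<in> Q" for a b c d e
    using that no(2)[of a] by (auto simp: eval_nat_numeral)
  have path3: "Q `` {a j} \<inter> Q `` {a (j + 3)} = {}" for j
    using pent[OF a(1)[of j] a(1)[of "Suc j"] a(1)[of "Suc (Suc j)"]] Q_sym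
    by (auto simp: eval_nat_numeral)
  have hit: "a j \<in> Q `` S \<or> a (j + 1) \<in> Q `` S \<or> a (j + 4) \<in> Q `` S" for j
  proof (rule ccontr)
    assume "\<not> ?thesis"
    then have far: "S \<inter> Q `` {a j} = {}" "S \<inter> Q `` {a (j + 1)} = {}" "S \<inter> Q `` {a (j + 4)} = {}"
      using Q_sym by blast+
    have in_M: "a i \<in> M" for i using a(1)[of i] Q_sub by auto
    show False
    proof (rule not_four_disjoint[OF S(1) nbr_sub nbr_sub nbr_sub far])
      show "Q `` {a j} \<inter> Q `` {a (j + 1)} = {}" unfolding Suc_eq_plus1[symmetric] using tri[OF a(1)[of j]] Q_sym by blast
      show "Q `` {a (j + 1)} \<inter> Q `` {a (j + 4)} = {}" using path3[of "j + 1"] by (simp add: add.commute)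
      have "a (j + 4 + 3) = a j" using a(2)[of j] by (simp add: eval_nat_numeral)
      then show "Q `` {a j} \<inter> Q `` {a (j + 4)} = {}" using path3[of "j + 4"] by (simp only: Int_commute)
    qed (use S degree in_M in auto)
  qed
  have per: "a 7 = a 0" "a 8 = a 1" "a 9 = a 2" "a 10 = a 3"
    using a(2)[of 0] a(2)[of 1] a(2)[of 2] a(2)[of 3] by simp_all
  define b where "b j \<longleftrightarrow> a j \<in> Q `` S" for j
  have "b 0 \<or> b 1 \<or> b 4" "b 1 \<or> b 2 \<or> b 5" "b 2 \<or> b 3 \<or> b 6" "b 3 \<or> b 4 \<or> b 0"
    "b 4 \<or> b 5 \<or> b 1" "b 5 \<or> b 6 \<or> b 2" "b 6 \<or> b 0 \<or> b 3"
    using hit[of 0] hit[of 1] hit[of 2] hit[of 3] hit[of 4] hit[of 5] hit[of 6] per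
    by (simp_all add: b_def eval_nat_numeral)
  then have "3 \<le> (of_bool (b 0) + of_bool (b 1) + of_bool (b 2) + of_bool (b 3) + of_bool (b 4) + of_bool (b 5) + of_bool (b 6) :: nat)"
    by (cases "b 0"; cases "b 1"; cases "b 2"; cases "b 3"; cases "b 4") auto
  then show ?thesis by (simp add: b_def eval_nat_numeral)
qed

text \<open>
  If the graph is bipartite, two cyclically consecutive sets \<open>Q `` S i\<close> both meet or both miss the
  smaller side, which has no room for two disjoint sets larger than a quarter. It can fail to be
  bipartite only if \<open>k = 2\<close> and there is a closed walk of length 7; the sets \<open>Q `` S i\<close> cover its
  positions at least 15 times in total but each position at most twice.
\<close>

lemma linked_consecutive_sets:
  assumes k: "2 \<le> k" and no: "\<And>a. (a, a) \<notin> Q ^^ (2 * k + 1)"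
    and S: "\<And>i. i \<le> 2 * k \<Longrightarrow> S i \<subseteq> M \<and> card M < 4 * card (S i)"
  shows "\<exists>i \<le> 2 * k. Q `` S i \<inter> Q `` S (Suc i mod (2 * k + 1)) \<noteq> {}"
proof (rule ccontr)
  assume "\<not> ?thesis"
  then have disj: "Q `` S i \<inter> Q `` S (Suc i mod (2 * k + 1)) = {}" if "i \<le> 2 * k" for i
    using that by blast
  \<comment> \<open>A shorter odd closed walk could be padded to length \<open>2 * k + 1\<close> by
    going back and forth along its first edge.\<close>
  have no': "(a, a) \<notin> Q ^^ (2 * j + 1)" if "j \<le> k" for a j
    using closed_walk_extend[of a "2 * j + 1" "k - j"] no[of a] that by (auto simp: algebra_simps)
  have no3: "(a, a) \<notin> Q ^^ 3" for a using no'[of 1 a] k by (simp add: numeral_3_eq_3)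
  have no5: "(a, a) \<notin> Q ^^ 5" for a using no'[of 2 a] k by simp
  have no7: "(a, a) \<notin> Q ^^ 7" for a
  proof (cases "k = 2")
    case False
    then show ?thesis using no'[of 3 a] k by simp
  next
    case k2: True
    show ?thesis
    proof
      assume "(a, a) \<in> Q ^^ 7"
      then obtain f where f: "f 0 = a" "f 7 = a" "\<And>i. i < 7 \<Longrightarrow> (f i, f (Suc i)) \<in> Q"
        unfolding relpow_fun_conv by blast
      define w where "w j = f (j mod 7)" for j
      have w1: "(w j, w (Suc j)) \<in> Q" for j
        using f(3)[of "j mod 7"] f(1,2) by (auto simp: w_def mod_Suc)
      have w2: "w (j + 7) = w j" for j by (simp add: w_def)
      define e where "e i j = (of_bool (w j \<in> Q `` S i) :: nat)" for i j
      have "(\<Sum>i<5::nat. (3 :: nat)) \<le> (\<Sum>i<5. \<Sum>j<7. e i j)"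
        unfolding e_def using S k2
        by (intro sum_mono seven_walk_meets_second_nbrs no3 no5 w1 w2) auto
      also have "\<dots> = (\<Sum>j<7. \<Sum>i<5. e i j)" by (rule sum.swap)
      also have "\<dots> \<le> (\<Sum>j<7::nat. 2)"
      proof (rule sum_mono)
        fix j
        define c where "c i \<longleftrightarrow> w j \<in> Q `` S i" for i
        have c: "\<not> (c i \<and> c (Suc i mod 5))" if "i \<le> 4" for i
          using disj[of i] that k2 by (auto simp: c_def)
        have "\<not> (c 0 \<and> c 1)" "\<not> (c 1 \<and> c 2)" "\<not> (c 2 \<and> c 3)" "\<not> (c 3 \<and> c 4)" "\<not> (c 4 \<and> c 0)"
          using c[of 0] c[of 1] c[of 2] c[of 3] c[of 4] by (simp_all add: numeral_2_eq_2)
        then have "of_bool (c 0) + of_bool (c 1) + of_bool (c 2) + of_bool (c 3) + of_bool (c 4) \<le> (2 :: nat)"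
          by (cases "c 0"; cases "c 1"; cases "c 2"; cases "c 3"; cases "c 4") auto
        then show "(\<Sum>i<5. e i j) \<le> 2"
          by (simp add: e_def c_def eval_nat_numeral)
      qed
      finally show False by simp
    qed
  qed
  have "M \<noteq> {}" using S[of 0] by auto
  then obtain P where P: "P \<subseteq> M" "\<And>a b. (a, b) \<in> Q \<Longrightarrow> (a \<in> P) \<noteq> (b \<in> P)"
    using bipartite_if_no_short_odd_closed_walk[OF no3 no5 no7] by blast
  \<comment> \<open>Exchanging the sides if necessary, \<open>P\<close> becomes the smaller
    one.\<close>
  have "\<exists>P \<subseteq> M. (\<forall>a b. (a, b) \<in> Q \<longrightarrow> (a \<in> P) \<noteq> (b \<in> P)) \<and> 2 * card P \<le> card M"
  proof (cases "2 * card P \<le> card M")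
    case False
    then have "2 * card (M - P) \<le> card M"
      using P(1) finite_M by (simp add: card_Diff_subset finite_subset)
    moreover have "(a \<in> M - P) \<noteq> (b \<in> M - P)" if "(a, b) \<in> Q" for a b
      using P(2)[OF that] that Q_sub by auto
    ultimately show ?thesis by blast
  qed (use P in blast)
  then obtain P where P: "P \<subseteq> M" "\<And>a b. (a, b) \<in> Q \<Longrightarrow> (a \<in> P) \<noteq> (b \<in> P)"
    and half: "2 * card P \<le> card M" by blast
  have finP: "finite P" using P finite_M finite_subset by blast
  define meets where "meets i \<longleftrightarrow> Q `` S i \<inter> P \<noteq> {}" for i
  have alt: "meets i \<noteq> meets (Suc i mod (2 * k + 1))" if i: "i \<le> 2 * k" for i
  proof
    define i' where "i' = Suc i mod (2 * k + 1)"
    have i': "i' \<le> 2 * k" unfolding i'_def using mod_less_divisor[of "2 * k + 1" "Suc i"] by linarith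
    have dj: "Q `` S i \<inter> Q `` S i' = {}" using disj[OF i] by (simp add: i'_def)
    assume "meets i = meets (Suc i mod (2 * k + 1))"
    then have eq: "meets i = meets i'" by (simp add: i'_def)
    \<comment> \<open>A member \<open>s\<close> with one neighbour in \<open>P\<close> lies off
      \<open>P\<close>, so its whole neighbourhood lies in \<open>P\<close>.\<close>
    have big: "\<exists>s. s \<in> M \<and> Q `` {s} \<subseteq> Q `` S l \<inter> P" if "meets l" for l
    proof -
      obtain s v where "s \<in> S l" "(s, v) \<in> Q" "v \<in> P" using \<open>meets l\<close> by (auto simp: meets_def)
      then have "Q `` {s} \<subseteq> Q `` S l \<inter> P" "s \<in> M" using P(2) Q_sub by blast+
      then show ?thesis by blast
    qed
    \<comment> \<open>No member has a neighbour in \<open>P\<close>, but each has some neighbour, so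
      all members lie in \<open>P\<close> themselves.\<close>
    have small: "S l \<subseteq> P" if l: "\<not> meets l" "l \<le> 2 * k" for l
    proof
      fix s assume s: "s \<in> S l"
      then obtain v where "(s, v) \<in> Q" using S[OF l(2)] ex_nbr by blast
      then show "s \<in> P" using s P(2)[of s v] l(1) by (auto simp: meets_def)
    qed
    show False
    proof (cases "meets i")
      case True
      then obtain s s' where s: "s \<in> M" "Q `` {s} \<subseteq> Q `` S i \<inter> P" and s': "s' \<in> M" "Q `` {s'} \<subseteq> Q `` S i' \<inter> P"
        using big eq by metis
      show False
        by (rule not_two_disjoint_halves[OF finP, of "Q `` {s}" "Q `` {s'}" "card M"])
          (use s s' dj half degree in auto)
    next
      case False
      have "S i \<inter> S i' = {}"
      proof (rule ccontr)
        assume "S i \<inter> S i' \<noteq> {}"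
        then obtain s where "s \<in> S i" "s \<in> S i'" by blast
        moreover then obtain v where "(s, v) \<in> Q" using S[OF i] ex_nbr by blast
        ultimately show False using dj by blast
      qed
      then show False
        using not_two_disjoint_halves[OF finP small[OF False i] small[OF _ i'] _ half] S[OF i] S[OF i'] False eq
        by blast
    qed
  qed
  \<comment> \<open>Alternation around a cycle of odd length \<open>2 * k + 1\<close> returns to
    position \<open>0\<close> with the wrong value.\<close>
  have parity: "meets i \<longleftrightarrow> (meets 0 \<longleftrightarrow> even i)" if "i \<le> 2 * k" for i
    using that
  proof (induction i)
    case (Suc i)
    then show ?case using alt[of i] by auto
  qed auto
  have "meets (2 * k) = meets 0" using parity[of "2 * k"] by auto
  then show False using alt[of "2 * k"] by simp
qed

end

section \<open>Samples of dense graphs\<close>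

lemma exists_sample_size:
  fixes c :: real and h :: nat
  assumes "c > 0"
  shows "\<exists>m. (real m + real h) * exp (1 - c * real m) \<le> 1 / 2"
proof -
  have "((\<lambda>m. (real m + real h) * exp (1 - c * real m)) \<longlongrightarrow> 0) at_top"
    using assms by real_asymp
  then have "eventually (\<lambda>m. (real m + real h) * exp (1 - c * real m) < 1 / 2) at_top"
    by (rule order_tendstoD) simp
  then obtain m where "(real m + real h) * exp (1 - c * real m) < 1 / 2"
    by (auto simp: eventually_at_top_linorder)
  then show ?thesis by (intro exI[of _ m]) simp
qed

text \<open>A union bound over the \<open>card W\<close> vertices of \<open>f\<close> and the
  \<open>m\<close> sampled vertices, each failing with small probability by the Chernoff bound at
  \<open>l = \<gamma> - \<gamma>'\<close>.\<close>

lemma card_dense_samples_ge: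
  fixes \<gamma> \<gamma>' :: real and f :: "'a \<Rightarrow> 'v"
  assumes fin: "finite V" "finite W" and R: "R \<subseteq> V \<times> V" "irrefl R"
    and deg: "\<And>v. v \<in> V \<Longrightarrow> \<gamma> * real (card V) \<le> real (card (R `` {v}))"
    and f: "f \<in> W \<rightarrow> V" and \<gamma>: "0 \<le> \<gamma>'" "\<gamma>' < \<gamma>" "\<gamma> \<le> 1"
    and m: "(real m + real (card W)) * exp (1 - (\<gamma> - \<gamma>')\<^sup>2 / 2 * real m) \<le> 1 / 2"
  shows "1 / 2 * real (card V) ^ m \<le> real (card {t \<in> {..<m} \<rightarrow>\<^sub>E V.
      (\<forall>i<m. \<gamma>' * real m < real (card {j \<in> {..<m}. t j \<in> R `` {t i}})) \<and>
      (\<forall>w\<in>W. \<gamma>' * real m < real (card {j \<in> {..<m}. t j \<in> R `` {f w}}))})" (is "_ \<le> real (card ?T)")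
proof -
  define n where "n = card V"
  define l where "l = \<gamma> - \<gamma>'"
  define b where "b = exp (1 - l\<^sup>2 / 2 * real m)"
  have l: "0 \<le> l" "l \<le> 1" using \<gamma> by (auto simp: l_def)
  have sub: "R `` {v} \<subseteq> V" for v using R by auto
  define BW where "BW w = {t \<in> {..<m} \<rightarrow>\<^sub>E V. real (card {j \<in> {..<m}. t j \<in> R `` {f w}}) \<le> \<gamma>' * real m}" for w
  define BI where "BI i = {t \<in> {..<m} \<rightarrow>\<^sub>E V. real (card {j \<in> {..<m}. t j \<in> R `` {t i}}) \<le> \<gamma>' * real m}" for i
  have finPi: "finite (J \<rightarrow>\<^sub>E V)" if "finite J" for J :: "nat set" using that fin by (intro finite_PiE) auto
  have finB: "finite (BW w)" "finite (BI i)" for w i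
    using finPi[of "{..<m}"] by (simp_all add: BW_def BI_def)
  \<comment> \<open>The case \<open>card J = m - 1\<close> serves the degree of a sampled vertex,
    whose own coordinate is set aside; the resulting loss is absorbed by the factor
    \<open>exp 1\<close> contained in \<open>b\<close>.\<close>
  have tail: "real (card {t \<in> J \<rightarrow>\<^sub>E V. real (card {j \<in> J. t j \<in> R `` {v}}) \<le> \<gamma>' * real m}) \<le> real n ^ card J * b"
    if "v \<in> V" "finite J" "real m - 1 \<le> real (card J)" for v J
  proof -
    have "\<gamma> * l - l\<^sup>2 / 2 \<ge> 0"
    proof -
      have "l * (l / 2) \<le> l * \<gamma>" using l \<gamma> by (intro mult_left_mono) (auto simp: l_def)
      then show ?thesis by (simp add: power2_eq_square algebra_simps)
    qed
    then have 1: "(\<gamma> * l - l\<^sup>2 / 2) * (real m - 1) \<le> (\<gamma> * l - l\<^sup>2 / 2) * real (card J)"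
      using that by (intro mult_left_mono) auto
    have 2: "l * (\<gamma>' * real m) - (\<gamma> * l - l\<^sup>2 / 2) * (real m - 1) = \<gamma> * l - l\<^sup>2 / 2 - l\<^sup>2 / 2 * real m"
      by (simp add: l_def power2_eq_square field_simps)
    have 3: "\<gamma> * l \<le> 1 * 1" using \<gamma> l by (intro mult_mono) auto
    have "l * (\<gamma>' * real m) - (\<gamma> * l - l\<^sup>2 / 2) * real (card J) \<le> 1 - l\<^sup>2 / 2 * real m"
    proof -
      have "l\<^sup>2 \<ge> 0" by simp
      then show ?thesis using 1 2 3 by linarith
    qed
    then have "exp (l * (\<gamma>' * real m) - (\<gamma> * l - l\<^sup>2 / 2) * real (card J)) \<le> b" by (simp add: b_def)
    then have "real (card V) ^ card J * exp (l * (\<gamma>' * real m) - (\<gamma> * l - l\<^sup>2 / 2) * real (card J)) \<le> real n ^ card J * b"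
      unfolding n_def by (intro mult_left_mono) auto
    moreover have "real (card {t \<in> J \<rightarrow>\<^sub>E V. real (card {j \<in> J. t j \<in> R `` {v}}) \<le> \<gamma>' * real m})
      \<le> real (card V) ^ card J * exp (l * (\<gamma>' * real m) - (\<gamma> * l - l\<^sup>2 / 2) * real (card J))"
      by (rule card_maps_few_hits_le) (use fin that sub deg l \<gamma> in auto)
    ultimately show ?thesis by linarith
  qed
  have cW: "real (card (BW w)) \<le> real n ^ m * b" if "w \<in> W" for w
    unfolding BW_def using tail[of "f w" "{..<m}"] f that by auto
  have cI: "real (card (BI i)) \<le> real n ^ m * b" if i: "i < m" for i
  proof -
    let ?J = "{..<m} - {i}"
    let ?C = "\<lambda>v. {t \<in> ?J \<rightarrow>\<^sub>E V. real (card {j \<in> ?J. t j \<in> R `` {v}}) \<le> \<gamma>' * real m}"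
    let ?s = "\<lambda>t :: nat \<Rightarrow> 'v. (t i, restrict t ?J)"
    have cJ: "card ?J = m - 1" using i by simp
    have "inj_on ?s (BI i)"
    proof (rule inj_onI)
      fix s t assume st: "s \<in> BI i" "t \<in> BI i" "?s s = ?s t"
      have "s j = t j" if "j \<in> {..<m}" for j
      proof (cases "j = i")
        case False
        have "restrict s ?J j = restrict t ?J j" using st by simp
        then show ?thesis using False that by simp
      qed (use st in auto)
      then show "s = t" using st by (auto simp: BI_def intro: PiE_ext)
    qed
    moreover have "?s ` BI i \<subseteq> Sigma V ?C"
    proof (rule image_subsetI)
      fix t assume t: "t \<in> BI i"
      then have tP: "t \<in> {..<m} \<rightarrow>\<^sub>E V" by (simp add: BI_def)
      have tV: "t i \<in> V" using tP i by auto
      have rP: "restrict t ?J \<in> ?J \<rightarrow>\<^sub>E V" unfolding restrict_PiE_iff using tP by auto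
      \<comment> \<open>By irreflexivity the coordinate \<open>i\<close> never counts towards the
        degree of \<open>t i\<close>, so dropping it leaves the number of hits unchanged.\<close>
      have "{j \<in> ?J. restrict t ?J j \<in> R `` {t i}} = {j \<in> {..<m}. t j \<in> R `` {t i}}"
        using R(2) by (auto simp: irrefl_def)
      then show "?s t \<in> Sigma V ?C" using t tV rP by (simp add: BI_def)
    qed
    moreover have "finite (Sigma V ?C)"
    proof (rule finite_SigmaI)
      fix v
      have "finite (?J \<rightarrow>\<^sub>E V)" by (rule finPi) simp
      then show "finite (?C v)" by simp
    qed (use fin in simp)
    ultimately have "card (BI i) \<le> card (Sigma V ?C)" by (rule card_inj_on_le)
    also have "\<dots> = (\<Sum>v\<in>V. card (?C v))"
    proof (rule card_SigmaI)
      show "\<forall>v\<in>V. finite (?C v)"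
      proof
        fix v
        have "finite (?J \<rightarrow>\<^sub>E V)" by (rule finPi) simp
        then show "finite (?C v)" by simp
      qed
    qed (use fin in simp)
    finally have "real (card (BI i)) \<le> real (\<Sum>v\<in>V. card (?C v))" by (simp only: of_nat_le_iff)
    also have "\<dots> = (\<Sum>v\<in>V. real (card (?C v)))" by (simp only: of_nat_sum)
    also have "\<dots> \<le> (\<Sum>v\<in>V. real n ^ (m - 1) * b)"
      using tail[of _ ?J] cJ i by (intro sum_mono) auto
    also have "\<dots> = real n * real n ^ (m - 1) * b" by (simp add: n_def)
    also have "real n * real n ^ (m - 1) = real n ^ m" using i by (cases m) auto
    finally show ?thesis .
  qed
  have "({..<m} \<rightarrow>\<^sub>E V) - ?T \<subseteq> (\<Union>w\<in>W. BW w) \<union> (\<Union>i<m. BI i)"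
    by (auto simp: BW_def BI_def not_less)
  then have "card (({..<m} \<rightarrow>\<^sub>E V) - ?T) \<le> card ((\<Union>w\<in>W. BW w) \<union> (\<Union>i<m. BI i))"
    using fin finB by (intro card_mono) auto
  also have "\<dots> \<le> (\<Sum>w\<in>W. card (BW w)) + (\<Sum>i<m. card (BI i))"
    using fin by (intro order.trans[OF card_Un_le] add_mono card_UN_le) auto
  finally have "real (card (({..<m} \<rightarrow>\<^sub>E V) - ?T)) \<le> (\<Sum>w\<in>W. real (card (BW w))) + (\<Sum>i<m. real (card (BI i)))"
    by (simp flip: of_nat_sum of_nat_add)
  also have "\<dots> \<le> (\<Sum>w\<in>W. real n ^ m * b) + (\<Sum>i<m. real n ^ m * b)"
    using cW cI by (intro add_mono sum_mono) auto
  also have "\<dots> = real n ^ m * ((real m + real (card W)) * b)" by (simp add: algebra_simps)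
  also have "\<dots> \<le> real n ^ m * (1 / 2)" using m by (intro mult_left_mono) (auto simp: b_def l_def)
  finally have bad: "real (card (({..<m} \<rightarrow>\<^sub>E V) - ?T)) \<le> real n ^ m * (1 / 2)" .
  have "card (({..<m} \<rightarrow>\<^sub>E V) - ?T) = card ({..<m} \<rightarrow>\<^sub>E V) - card ?T"
    using finPi[of "{..<m}"] by (intro card_Diff_subset) auto
  moreover have "card ?T \<le> card ({..<m} \<rightarrow>\<^sub>E V)" using finPi[of "{..<m}"] by (intro card_mono) auto
  moreover have "card ({..<m} \<rightarrow>\<^sub>E V) = n ^ m" by (simp add: card_PiE n_def)
  ultimately have "real (card (({..<m} \<rightarrow>\<^sub>E V) - ?T)) = real n ^ m - real (card ?T)"
    by (simp add: of_nat_diff)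
  with bad show ?thesis by (simp add: n_def)
qed

text \<open>The blow-up yields maps of order \<open>n ^ card P\<close>, where
  \<open>n = card V\<close>, and the degenerate ones are only of order
  \<open>n ^ (card P - 1)\<close>; \<open>large\<close> makes them cost at most half of the
  bound.\<close>

lemma card_injective_pattern_maps_ge:
  fixes V :: "'v set" and I :: "'i set" and P :: "'p set" and c :: real
  assumes fin: "finite V" "finite I" "finite P" "finite B" and V: "V \<noteq> {}" and \<phi>: "\<phi> \<in> P \<rightarrow> I"
    and E: "E \<subseteq> P \<times> P" and R: "irrefl R" and c: "0 < c"
    and dense: "c * real (card V) ^ card I \<le>
      card {t \<in> I \<rightarrow>\<^sub>E V. (\<forall>(p, q)\<in>E. (t (\<phi> p), t (\<phi> q)) \<in> R) \<and> (\<forall>p\<in>P. t (\<phi> p) \<in> A p)}"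
    and large: "2 * real ((card P + card B) * card P) \<le> c ^ (2 ^ card P) * real (card V)"
  shows "c ^ (2 ^ card P) / 2 * real (card V) ^ card P \<le>
      card {g \<in> P \<rightarrow>\<^sub>E V. inj_on g P \<and> g ` P \<inter> B = {} \<and> (\<forall>(p, q)\<in>E. (g p, g q) \<in> R) \<and> (\<forall>p\<in>P. g p \<in> A p)}"
proof -
  let ?T = "{t \<in> I \<rightarrow>\<^sub>E V. (\<forall>(p, q)\<in>E. (t (\<phi> p), t (\<phi> q)) \<in> R) \<and> (\<forall>p\<in>P. t (\<phi> p) \<in> A p)}"
  let ?G = "{g \<in> P \<rightarrow>\<^sub>E V. (\<forall>(p, q)\<in>E. (g p, g q) \<in> R) \<and> (\<forall>p\<in>P. g p \<in> A p)}"
  let ?N = "{g \<in> P \<rightarrow>\<^sub>E V. \<not> (inj_on g P \<and> g ` P \<inter> B = {})}"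
  let ?C = "{g \<in> P \<rightarrow>\<^sub>E V. inj_on g P \<and> g ` P \<inter> B = {} \<and> (\<forall>(p, q)\<in>E. (g p, g q) \<in> R) \<and> (\<forall>p\<in>P. g p \<in> A p)}"
  define d where "d = c ^ (2 ^ card P)"
  have n: "card V > 0" using fin V by (simp add: card_gt_0_iff)
  \<comment> \<open>Density supplies one admissible tuple. As \<open>R\<close> is irreflexive, this
    tuple shows that \<open>\<phi>\<close> separates the ends of every arc, as the blow-up
    requires.\<close>
  have "0 < c * real (card V) ^ card I" using c n by simp
  then have "0 < real (card ?T)" using dense by (rule less_le_trans)
  then have "?T \<noteq> {}" by (auto simp only: card.empty of_nat_0)
  then obtain t where "t \<in> ?T" by blast
  then have t: "(t (\<phi> p), t (\<phi> q)) \<in> R" if "(p, q) \<in> E" for p q using that by auto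
  have E': "p \<in> P \<and> q \<in> P \<and> \<phi> p \<noteq> \<phi> q" if "(p, q) \<in> E" for p q
    using t[OF that] that E R by (auto simp: irrefl_def)
  have G: "d * real (card V) ^ card P \<le> card ?G"
    unfolding d_def using card_pattern_maps_ge[OF fin(1-3) V \<phi> E' _ dense] c by simp
  have finPi: "finite (P \<rightarrow>\<^sub>E V)" using fin by (intro finite_PiE) auto
  have "?G \<subseteq> ?C \<union> ?N" by auto
  then have "card ?G \<le> card (?C \<union> ?N)" using finPi by (intro card_mono) auto
  also have "\<dots> \<le> card ?C + card ?N" by (rule card_Un_le)
  finally have "real (card ?G) \<le> real (card ?C) + real (card ?N)" by simp
  moreover have "real (card ?N) \<le> d / 2 * real (card V) ^ card P"
  proof -
    have "real (card ?N) \<le> real ((card P + card B) * card P * card V ^ (card P - 1))"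
      using card_non_injective_maps_le[OF fin(1,3,4)] by (simp only: of_nat_le_iff)
    also have "\<dots> = real ((card P + card B) * card P) * real (card V) ^ (card P - 1)" by simp
    also have "\<dots> \<le> d / 2 * real (card V) ^ card P"
    proof (cases "card P = 0")
      case True
      then show ?thesis using c by (simp add: d_def)
    next
      case False
      have "real ((card P + card B) * card P) \<le> d / 2 * real (card V)" using large by (simp add: d_def)
      then have "real ((card P + card B) * card P) * real (card V) ^ (card P - 1)
          \<le> d / 2 * real (card V) * real (card V) ^ (card P - 1)" by (intro mult_right_mono) auto
      also have "\<dots> = d / 2 * real (card V) ^ card P" using False by (cases "card P") auto
      finally show ?thesis .
    qed
    finally show ?thesis .
  qed
  ultimately have "d / 2 * real (card V) ^ card P \<le> real (card ?C)" using G by (simp add: field_simps)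
  then show ?thesis by (simp add: d_def)
qed

section \<open>From samples to linear removal\<close>

lemma out_degree_with_proj: "out_degree (with_proj G) v = card (parcs G `` {v})"
proof -
  have "out_arcs (with_proj G) v = Pair v ` (parcs G `` {v})"
    by (auto simp: out_arcs_def)
  then show ?thesis by (simp add: out_degree_def card_image inj_on_def)
qed

lemma pair_graph_arcs:
  assumes "pair_graph G"
  shows "finite (pverts G)" "finite (parcs G)" "parcs G \<subseteq> pverts G \<times> pverts G" "irrefl (parcs G)"
    "(u, v) \<in> parcs G \<Longrightarrow> (v, u) \<in> parcs G"
proof -
  interpret pair_graph G by fact
  show "finite (pverts G)" "finite (parcs G)" by auto
  show "parcs G \<subseteq> pverts G \<times> pverts G" using wellformed' by auto
  show "irrefl (parcs G)" using no_loops' by (auto simp: irrefl_def)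
  show "(u, v) \<in> parcs G \<Longrightarrow> (v, u) \<in> parcs G" by (simp add: arcs_symmetric)
qed

lemma finite_copies:
  assumes "finite (pverts H)" "finite (pverts G)"
  shows "finite (copies H G)"
proof -
  have "finite (pverts H \<rightarrow>\<^sub>E pverts G)" using assms by (intro finite_PiE) auto
  then show ?thesis by (simp add: copies_def)
qed

text \<open>
  \<open>Q\<close> is the graph spanned by a sample of \<open>m\<close> vertices of the host and \<open>S v\<close> is the set of sampled
  neighbours of the vertex \<open>v\<close> of a copy of \<open>H\<close>: either the sample contains a homomorphic image of
  \<open>H\<close>, or some arc \<open>(u, v)\<close> of the copy extends to one in which it plays the role of \<open>(x, y)\<close>.
\<close>

definition forcing :: "'a pair_pre_digraph \<Rightarrow> real \<Rightarrow> 'a \<Rightarrow> 'a \<Rightarrow> bool" where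
  "forcing H \<gamma> x y \<longleftrightarrow> (\<forall>(m :: nat) Q S.
     Q \<subseteq> {..<m} \<times> {..<m} \<longrightarrow> sym Q \<longrightarrow> irrefl Q \<longrightarrow>
     (\<forall>i<m. \<gamma> * real m < real (card (Q `` {i}))) \<longrightarrow>
     (\<forall>v\<in>pverts H. S v \<subseteq> {..<m} \<and> \<gamma> * real m < real (card (S v))) \<longrightarrow>
     (\<exists>\<phi>\<in>pverts H \<rightarrow> {..<m}. \<forall>(p, q)\<in>parcs H. (\<phi> p, \<phi> q) \<in> Q) \<or>
     (\<exists>(u, v)\<in>parcs H. \<exists>\<phi>\<in>pverts H - {x, y} \<rightarrow> {..<m}.
        (\<forall>(p, q)\<in>parcs H. p \<notin> {x, y} \<longrightarrow> q \<notin> {x, y} \<longrightarrow> (\<phi> p, \<phi> q) \<in> Q) \<and>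
        (\<forall>p\<in>pverts H - {x, y}. ((x, p) \<in> parcs H \<longrightarrow> \<phi> p \<in> S u) \<and> ((y, p) \<in> parcs H \<longrightarrow> \<phi> p \<in> S v))))"

lemma ex_dense_in_cover:
  fixes c :: real
  assumes "finite \<Omega>" "T \<subseteq> (\<Union>o'\<in>\<Omega>. X o')" "\<And>o'. o' \<in> \<Omega> \<Longrightarrow> finite (X o')" "real (card \<Omega>) * c < real (card T)"
  shows "\<exists>o'\<in>\<Omega>. c \<le> real (card (X o'))"
proof (rule ccontr)
  assume "\<not> ?thesis"
  then have less: "real (card (X o')) \<le> c" if "o' \<in> \<Omega>" for o' using that by fastforce
  have "card T \<le> card (\<Union>o'\<in>\<Omega>. X o')" using assms by (intro card_mono) auto
  also have "\<dots> \<le> (\<Sum>o'\<in>\<Omega>. card (X o'))" using assms by (intro card_UN_le) auto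
  finally have "real (card T) \<le> real (\<Sum>o'\<in>\<Omega>. card (X o'))" by (simp only: of_nat_le_iff)
  also have "\<dots> = (\<Sum>o'\<in>\<Omega>. real (card (X o')))" by (simp only: of_nat_sum)
  also have "\<dots> \<le> (\<Sum>o'\<in>\<Omega>. c)" using less by (intro sum_mono)
  finally show False using assms by simp
qed

text \<open>At least half of all samples are dense, and forcing assigns to each of them one of
  boundedly many outcomes. Some outcome is therefore shared by a positive fraction of the samples,
  and the blow-up turns it into injective copies. The number of outcomes depends on \<open>H\<close>
  and \<open>m\<close> only, so \<open>d\<close> and \<open>n0\<close> are uniform in the
  host.\<close>

lemma copies_through_arc_or_everywhere:
  fixes H :: "'a pair_pre_digraph" and \<gamma> \<gamma>' :: real
  assumes H: "pair_graph H" and xy: "(x, y) \<in> parcs H" and force: "forcing H \<gamma>' x y"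
    and \<gamma>: "0 \<le> \<gamma>'" "\<gamma>' < \<gamma>" "\<gamma> \<le> 1"
  shows "\<exists>d>0. \<exists>n0. \<forall>G :: nat pair_pre_digraph. \<forall>f\<in>copies H G.
    pair_graph G \<longrightarrow> n0 \<le> card (pverts G) \<longrightarrow> min_degree_ge G (\<gamma> * real (card (pverts G))) \<longrightarrow>
    d * real (card (pverts G)) ^ card (pverts H) \<le> real (card (copies H G)) \<or>
    d * real (card (pverts G)) ^ (card (pverts H) - 2)
      \<le> real (card {g \<in> copies H G. \<exists>(u, v)\<in>parcs H. g x = f u \<and> g y = f v})"
proof -
  note HF = pair_graph_arcs[OF H]
  define W where "W = pverts H"
  define h where "h = card W"
  define P where "P = W - {x, y}"
  have finW: "finite W" using HF by (simp add: W_def)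
  have finP: "finite P" using finW by (simp add: P_def)
  have xW: "x \<in> W" "y \<in> W" "x \<noteq> y" using xy HF by (auto simp: W_def irrefl_def)
  have cP: "card P = h - 2" unfolding P_def h_def using xW finW by (simp add: card_Diff_subset)
  have "(\<gamma> - \<gamma>')\<^sup>2 / 2 > 0" using \<gamma> by simp
  then obtain m where m: "(real m + real (card W)) * exp (1 - (\<gamma> - \<gamma>')\<^sup>2 / 2 * real m) \<le> 1 / 2"
    using exists_sample_size by blast
  define \<Omega>1 where "\<Omega>1 = (W \<rightarrow>\<^sub>E {..<m})"
  define \<Omega>2 where "\<Omega>2 = parcs H \<times> (P \<rightarrow>\<^sub>E {..<m})"
  define \<Omega> where "\<Omega> = Inl ` \<Omega>1 \<union> Inr ` \<Omega>2"
  have fin\<Omega>: "finite \<Omega>" unfolding \<Omega>_def \<Omega>1_def \<Omega>2_def using finW finP HF by (auto intro!: finite_PiE)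
  \<comment> \<open>\<open>\<Omega>\<close> lists the possible outcomes; if each occurred with
    density below \<open>c\<close>, together they would cover less than half of the samples.\<close>
  define c where "c = 1 / (2 * (real (card \<Omega>) + 1))"
  have c: "0 < c" "c \<le> 1" by (auto simp: c_def field_simps)
  \<comment> \<open>As \<open>c \<le> 1\<close>, the exponent for \<open>h\<close> pattern vertices
    gives a constant that is valid for both kinds of outcome.\<close>
  define d where "d = c ^ (2 ^ h) / 2"
  have d: "d > 0" using c by (simp add: d_def)
  have d_le: "d \<le> c ^ (2 ^ k) / 2" if "k \<le> h" for k
  proof -
    have "(2 :: nat) ^ k \<le> 2 ^ h" using that by simp
    then have "c ^ (2 ^ h) \<le> c ^ (2 ^ k)" using c by (rule power_decreasing[OF _ less_imp_le])
    then show ?thesis by (simp add: d_def)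
  qed
  obtain n0 where n0: "2 * real ((h + 2) * h) \<le> 2 * d * real n0" "n0 > 0"
  proof -
    obtain k :: nat where "real ((h + 2) * h) / d < real k" using reals_Archimedean2 by blast
    then have "real ((h + 2) * h) < d * real k" using d by (simp add: field_simps)
    moreover have "d * real k \<le> d * real (Suc k)" using d by simp
    ultimately show ?thesis using that[of "Suc k"] by simp
  qed
  have large: "2 * real ((card Y + b) * card Y) \<le> c ^ (2 ^ card Y) * real n"
    if "card Y \<le> h" "b \<le> 2" "n0 \<le> n" for Y :: "'a set" and b n
  proof -
    have "(card Y + b) * card Y \<le> (h + 2) * h" using that by (intro mult_mono) auto
    then have "2 * real ((card Y + b) * card Y) \<le> 2 * real ((h + 2) * h)"
      using of_nat_mono[where 'a = real] by (metis mult_le_cancel_left_pos zero_less_numeral)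
    also have "\<dots> \<le> 2 * d * real n0" by (rule n0)
    also have "\<dots> \<le> 2 * d * real n" using that d by simp
    also have "\<dots> \<le> c ^ (2 ^ card Y) * real n"
      using d_le[OF that(1)] by (intro mult_right_mono) auto
    finally show ?thesis .
  qed
  have main: "d * real (card (pverts G)) ^ card (pverts H) \<le> real (card (copies H G)) \<or>
    d * real (card (pverts G)) ^ (card (pverts H) - 2)
      \<le> real (card {g \<in> copies H G. \<exists>(u, v)\<in>parcs H. g x = f u \<and> g y = f v})"
    if G: "pair_graph G" and f: "f \<in> copies H G" and n: "n0 \<le> card (pverts G)"
      and deg: "min_degree_ge G (\<gamma> * real (card (pverts G)))" for G :: "nat pair_pre_digraph" and f
  proof -
    note GF = pair_graph_arcs[OF G]
    define V where "V = pverts G"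
    define R where "R = parcs G"
    have finV: "finite V" using GF by (simp add: V_def)
    have V0: "V \<noteq> {}" using n n0 by (auto simp: V_def)
    have nV: "n0 \<le> card V" using n by (simp add: V_def)
    have RV: "R \<subseteq> V \<times> V" and irR: "irrefl R" using GF by (auto simp: R_def V_def)
    have symR: "(a, b) \<in> R \<Longrightarrow> (b, a) \<in> R" for a b using GF by (simp add: R_def)
    have fW: "f \<in> W \<rightarrow> V" using f by (auto simp: copies_def W_def V_def)
    have farc: "(f u, f v) \<in> R" if "(u, v) \<in> parcs H" for u v
      using f that by (auto simp: copies_def R_def)
    define E where "E = {(p, q) \<in> parcs H. p \<notin> {x, y} \<and> q \<notin> {x, y}}"
    have EP: "E \<subseteq> P \<times> P" using HF by (auto simp: E_def P_def W_def)
    \<comment> \<open>The host vertices that may represent \<open>p\<close> once \<open>x\<close>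
      and \<open>y\<close> are placed at \<open>f u\<close> and \<open>f v\<close>.\<close>
    define A where "A u v p = {w \<in> V. ((x, p) \<in> parcs H \<longrightarrow> (f u, w) \<in> R) \<and> ((y, p) \<in> parcs H \<longrightarrow> (f v, w) \<in> R)}"
      for u v p
    define X1 where "X1 \<phi> = {t \<in> {..<m} \<rightarrow>\<^sub>E V. (\<forall>(p, q)\<in>parcs H. (t (\<phi> p), t (\<phi> q)) \<in> R) \<and> (\<forall>p\<in>W. t (\<phi> p) \<in> V)}" for \<phi>
    define X2 where "X2 u v \<phi> = {t \<in> {..<m} \<rightarrow>\<^sub>E V. (\<forall>(p, q)\<in>E. (t (\<phi> p), t (\<phi> q)) \<in> R) \<and> (\<forall>p\<in>P. t (\<phi> p) \<in> A u v p)}" for u v \<phi>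
    define X where "X z = (case z of Inl \<phi> \<Rightarrow> X1 \<phi> | Inr ((u, v), \<phi>) \<Rightarrow> X2 u v \<phi>)" for z
    define T where "T = {t \<in> {..<m} \<rightarrow>\<^sub>E V.
      (\<forall>i<m. \<gamma>' * real m < real (card {j \<in> {..<m}. t j \<in> R `` {t i}})) \<and>
      (\<forall>w\<in>W. \<gamma>' * real m < real (card {j \<in> {..<m}. t j \<in> R `` {f w}}))}"
    have Rdeg: "\<gamma> * real (card V) \<le> real (card (R `` {v}))" if "v \<in> V" for v
      using deg that by (simp add: min_degree_ge_def out_degree_with_proj V_def R_def)
    have half: "1 / 2 * real (card V) ^ m \<le> real (card T)"
      unfolding T_def using card_dense_samples_ge[OF finV finW RV irR Rdeg fW \<gamma> m] .
    have cover: "T \<subseteq> (\<Union>z\<in>\<Omega>. X z)"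
    proof
      fix t assume t: "t \<in> T"
      then have tP: "t \<in> {..<m} \<rightarrow>\<^sub>E V" by (simp add: T_def)
      define Q where "Q = {(i, j). i < m \<and> j < m \<and> (t i, t j) \<in> R}"
      define S where "S v = {j \<in> {..<m}. t j \<in> R `` {f v}}" for v
      have "Q \<subseteq> {..<m} \<times> {..<m}" "sym Q" "irrefl Q"
        using symR irR by (auto simp: Q_def sym_def irrefl_def)
      moreover have "\<forall>i<m. \<gamma>' * real m < real (card (Q `` {i}))"
      proof (intro allI impI)
        fix i assume "i < m"
        then have "Q `` {i} = {j \<in> {..<m}. t j \<in> R `` {t i}}" by (auto simp: Q_def)
        then show "\<gamma>' * real m < real (card (Q `` {i}))" using t \<open>i < m\<close> by (simp add: T_def)
      qed
      moreover have "\<forall>v\<in>pverts H. S v \<subseteq> {..<m} \<and> \<gamma>' * real m < real (card (S v))"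
        using t by (auto simp: S_def T_def W_def)
      ultimately have "(\<exists>\<phi>\<in>pverts H \<rightarrow> {..<m}. \<forall>(p, q)\<in>parcs H. (\<phi> p, \<phi> q) \<in> Q) \<or>
        (\<exists>(u, v)\<in>parcs H. \<exists>\<phi>\<in>pverts H - {x, y} \<rightarrow> {..<m}.
        (\<forall>(p, q)\<in>parcs H. p \<notin> {x, y} \<longrightarrow> q \<notin> {x, y} \<longrightarrow> (\<phi> p, \<phi> q) \<in> Q) \<and>
        (\<forall>p\<in>pverts H - {x, y}. ((x, p) \<in> parcs H \<longrightarrow> \<phi> p \<in> S u) \<and> ((y, p) \<in> parcs H \<longrightarrow> \<phi> p \<in> S v)))"
        using force unfolding forcing_def by blast
      then show "t \<in> (\<Union>z\<in>\<Omega>. X z)"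
      proof
        assume "\<exists>\<phi>\<in>pverts H \<rightarrow> {..<m}. \<forall>(p, q)\<in>parcs H. (\<phi> p, \<phi> q) \<in> Q"
        then obtain \<phi> where \<phi>: "\<phi> \<in> W \<rightarrow> {..<m}" and e: "\<And>p q. (p, q) \<in> parcs H \<Longrightarrow> (\<phi> p, \<phi> q) \<in> Q"
          unfolding W_def by blast
        let ?\<phi> = "restrict \<phi> W"
        have r: "?\<phi> \<in> \<Omega>1" using \<phi> unfolding \<Omega>1_def restrict_PiE_iff by auto
        have "(t (?\<phi> p), t (?\<phi> q)) \<in> R" if "(p, q) \<in> parcs H" for p q
        proof -
          have "p \<in> W" "q \<in> W" using that HF by (auto simp: W_def)
          then show ?thesis using e[OF that] by (simp add: Q_def)
        qed
        moreover have "t (?\<phi> p) \<in> V" if "p \<in> W" for p using that \<phi> tP by auto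
        ultimately have "t \<in> X1 ?\<phi>" using tP unfolding X1_def by blast
        then have "t \<in> X (Inl ?\<phi>)" by (simp add: X_def)
        moreover have "Inl ?\<phi> \<in> \<Omega>" using r by (simp add: \<Omega>_def)
        ultimately show ?thesis by (rule UN_I[rotated])
      next
        assume "\<exists>(u, v)\<in>parcs H. \<exists>\<phi>\<in>pverts H - {x, y} \<rightarrow> {..<m}.
          (\<forall>(p, q)\<in>parcs H. p \<notin> {x, y} \<longrightarrow> q \<notin> {x, y} \<longrightarrow> (\<phi> p, \<phi> q) \<in> Q) \<and>
          (\<forall>p\<in>pverts H - {x, y}. ((x, p) \<in> parcs H \<longrightarrow> \<phi> p \<in> S u) \<and> ((y, p) \<in> parcs H \<longrightarrow> \<phi> p \<in> S v))"
        then obtain u v \<phi> where uv: "(u, v) \<in> parcs H" and \<phi>: "\<phi> \<in> P \<rightarrow> {..<m}"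
          and e': "\<forall>(p, q)\<in>parcs H. p \<notin> {x, y} \<longrightarrow> q \<notin> {x, y} \<longrightarrow> (\<phi> p, \<phi> q) \<in> Q"
          and s': "\<forall>p\<in>P. ((x, p) \<in> parcs H \<longrightarrow> \<phi> p \<in> S u) \<and> ((y, p) \<in> parcs H \<longrightarrow> \<phi> p \<in> S v)"
          by (elim bexE case_prodE conjE) (simp add: P_def W_def)
        have e: "(\<phi> p, \<phi> q) \<in> Q" if "(p, q) \<in> E" for p q
          using e' that by (auto simp: E_def)
        note s = s'[rule_format]
        let ?\<phi> = "restrict \<phi> P"
        have r: "((u, v), ?\<phi>) \<in> \<Omega>2" using \<phi> uv unfolding \<Omega>2_def mem_Times_iff by (simp add: restrict_PiE_iff Pi_iff)
        have "(t (?\<phi> p), t (?\<phi> q)) \<in> R" if "(p, q) \<in> E" for p q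
          using that e[OF that] EP by (auto simp: Q_def)
        moreover have "t (?\<phi> p) \<in> A u v p" if "p \<in> P" for p
          using s[OF that] that \<phi> tP by (auto simp: A_def S_def)
        ultimately have "t \<in> X2 u v ?\<phi>" using tP unfolding X2_def by blast
        then have "t \<in> X (Inr ((u, v), ?\<phi>))" by (simp add: X_def)
        moreover have "Inr ((u, v), ?\<phi>) \<in> \<Omega>" using r by (simp add: \<Omega>_def)
        ultimately show ?thesis by (rule UN_I[rotated])
      qed
    qed
    have finX: "finite (X z)" for z
    proof -
      have "finite ({..<m} \<rightarrow>\<^sub>E V)" using finV by (intro finite_PiE) auto
      then show ?thesis by (auto simp: X_def X1_def X2_def split: sum.split prod.split)
    qed
    have "real (card \<Omega>) * (c * real (card V) ^ m) < real (card T)"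
    proof -
      have "real (card \<Omega>) * c < 1 / 2" by (simp add: c_def field_simps)
      moreover have pos: "real (card V) ^ m > 0" using V0 finV by (simp add: card_gt_0_iff)
      ultimately have "real (card \<Omega>) * c * real (card V) ^ m < 1 / 2 * real (card V) ^ m"
        by (rule mult_strict_right_mono)
      then show ?thesis using half by (simp only: mult.assoc)
    qed
    then obtain z where z: "z \<in> \<Omega>" "c * real (card V) ^ m \<le> real (card (X z))"
      using ex_dense_in_cover[OF fin\<Omega> cover finX] by blast
    show ?thesis
    proof (cases z)
      case (Inl \<phi>)
      let ?C = "{g \<in> W \<rightarrow>\<^sub>E V. inj_on g W \<and> g ` W \<inter> {} = {} \<and> (\<forall>(p, q)\<in>parcs H. (g p, g q) \<in> R) \<and> (\<forall>p\<in>W. g p \<in> V)}"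
      have \<phi>: "\<phi> \<in> W \<rightarrow> {..<m}" using z Inl by (auto simp: \<Omega>_def \<Omega>1_def)
      have "c ^ (2 ^ card W) / 2 * real (card V) ^ card W \<le> real (card ?C)"
      proof (rule card_injective_pattern_maps_ge[OF finV _ finW _ V0 \<phi> _ irR c(1)])
        show "c * real (card V) ^ card {..<m} \<le> real (card {t \<in> {..<m} \<rightarrow>\<^sub>E V. (\<forall>(p, q)\<in>parcs H. (t (\<phi> p), t (\<phi> q)) \<in> R) \<and> (\<forall>p\<in>W. t (\<phi> p) \<in> V)})"
          using z Inl by (simp add: X_def X1_def)
        show "2 * real ((card W + card {}) * card W) \<le> c ^ (2 ^ card W) * real (card V)"
          by (rule large) (use nV in \<open>auto simp: h_def\<close>)
      qed (use HF in \<open>auto simp: W_def\<close>)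
      moreover have "?C = copies H G" by (auto simp: copies_def W_def V_def R_def)
      moreover have "d * real (card V) ^ card W \<le> c ^ (2 ^ card W) / 2 * real (card V) ^ card W"
        by (intro mult_right_mono d_le) (auto simp: h_def)
      ultimately show ?thesis by (simp add: W_def V_def)
    next
      case (Inr w)
      obtain u v \<phi> where w: "w = ((u, v), \<phi>)" by (metis surj_pair)
      \<comment> \<open>Avoiding \<open>f u\<close> and \<open>f v\<close> keeps the map injective
        when \<open>x\<close> and \<open>y\<close> are placed there.\<close>
      let ?C = "{g \<in> P \<rightarrow>\<^sub>E V. inj_on g P \<and> g ` P \<inter> {f u, f v} = {} \<and> (\<forall>(p, q)\<in>E. (g p, g q) \<in> R) \<and> (\<forall>p\<in>P. g p \<in> A u v p)}"
      let ?D = "{g \<in> copies H G. \<exists>(u, v)\<in>parcs H. g x = f u \<and> g y = f v}"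
      have uv: "(u, v) \<in> parcs H" and \<phi>: "\<phi> \<in> P \<rightarrow> {..<m}" using z Inr w by (auto simp: \<Omega>_def \<Omega>2_def)
      have "c ^ (2 ^ card P) / 2 * real (card V) ^ card P \<le> real (card ?C)"
      proof (rule card_injective_pattern_maps_ge[OF finV _ finP _ V0 \<phi> EP irR c(1)])
        show "c * real (card V) ^ card {..<m} \<le> real (card {t \<in> {..<m} \<rightarrow>\<^sub>E V. (\<forall>(p, q)\<in>E. (t (\<phi> p), t (\<phi> q)) \<in> R) \<and> (\<forall>p\<in>P. t (\<phi> p) \<in> A u v p)})"
          using z Inr w by (simp add: X_def X2_def)
        have "card {f u, f v} \<le> 2" by (simp add: card_insert_if)
        then show "2 * real ((card P + card {f u, f v}) * card P) \<le> c ^ (2 ^ card P) * real (card V)"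
          by (intro large) (use nV cP in auto)
      qed auto
      moreover have "card ?C \<le> card ?D"
      proof (rule card_inj_on_le)
        let ?ext = "\<lambda>g. g(x := f u, y := f v)"
        show "inj_on ?ext ?C"
        proof (rule inj_onI)
          fix g g' assume g: "g \<in> ?C" and g': "g' \<in> ?C" and eq: "?ext g = ?ext g'"
          have "g p = g' p" if "p \<in> P" for p
          proof -
            have "p \<noteq> x" "p \<noteq> y" using that by (auto simp: P_def)
            then show ?thesis using fun_cong[OF eq, of p] by simp
          qed
          then show "g = g'" using g g' by (auto intro: PiE_ext)
        qed
        show "?ext ` ?C \<subseteq> ?D"
        proof (rule image_subsetI)
          fix g assume g: "g \<in> ?C"
          define k where "k = ?ext g"
          have kx: "k x = f u" "k y = f v" using xW by (auto simp: k_def)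
          have kP: "k p = g p" if "p \<in> P" for p using that by (auto simp: k_def P_def)
          have fuv: "f u \<in> V" "f v \<in> V" "f u \<noteq> f v" using farc[OF uv] RV irR by (auto simp: irrefl_def)
          have gPiE: "g \<in> P \<rightarrow>\<^sub>E V" using g by simp
          have kW: "k \<in> W \<rightarrow>\<^sub>E V"
          proof (rule PiE_I)
            fix p assume "p \<in> W"
            then consider "p = x" | "p = y" | "p \<in> P" by (auto simp: P_def)
            then show "k p \<in> V" using kx kP fuv PiE_mem[OF gPiE] by cases auto
          next
            fix p assume "p \<notin> W"
            then show "k p = undefined" using xW PiE_arb[OF gPiE, of p] by (auto simp: k_def P_def)
          qed
          have WP: "W = insert x (insert y P)" using xW by (auto simp: P_def)
          have kim: "k ` P = g ` P" using kP by auto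
          have "inj_on k P" using g kP by (auto simp: inj_on_def)
          then have inj: "inj_on k W"
            unfolding WP using g kx kim fuv xW by (auto simp: inj_on_insert P_def)
          have gA: "g p \<in> A u v p" if "p \<in> P" for p using g that by blast
          have "(k p, k q) \<in> R" if pq: "(p, q) \<in> parcs H" for p q
          proof -
            have ne: "p \<noteq> q" using pq HF by (auto simp: irrefl_def)
            have qp: "(q, p) \<in> parcs H" using pq HF by blast
            have pqW: "p \<in> W" "q \<in> W" using pq HF by (auto simp: W_def)
            have root: "(k r, k s) \<in> R" if "r \<in> {x, y}" "s \<in> P" "(r, s) \<in> parcs H" for r s
              using that gA[of s] kx kP by (auto simp: A_def)
            consider "p \<in> P" "q \<in> P" | "p \<in> P" "q \<in> {x, y}" | "p \<in> {x, y}" "q \<in> P"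
              | "p = x" "q = y" | "p = y" "q = x"
              using pqW ne by (auto simp: P_def)
            then show ?thesis
            proof cases
              case 1
              then have "(p, q) \<in> E" using pq by (auto simp: E_def P_def)
              then have "(g p, g q) \<in> R" using g by blast
              then show ?thesis using 1 kP by simp
            next
              case 2
              then show ?thesis using root[of q p] qp symR by blast
            next
              case 3
              then show ?thesis using root[of p q] pq by blast
            next
              case 4
              then show ?thesis using kx farc[OF uv] by simp
            next
              case 5
              then show ?thesis using kx farc[OF uv] symR by simp
            qed
          qed
          then have "k \<in> copies H G" using kW inj by (auto simp: copies_def W_def V_def R_def)
          then show "?ext g \<in> ?D" using uv kx unfolding k_def by blast
        qed
        show "finite ?D" using finite_copies[OF HF(1) GF(1)] by simp
      qed
      moreover have "d * real (card V) ^ card P \<le> c ^ (2 ^ card P) / 2 * real (card V) ^ card P"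
        by (intro mult_right_mono d_le) (auto simp: cP)
      ultimately have "d * real (card V) ^ card P \<le> real (card ?D)" by linarith
      then show ?thesis by (simp add: cP h_def W_def V_def)
    qed
  qed
  show ?thesis
    by (rule exI[of _ d], rule conjI[OF d], rule exI[of _ n0]) (use main in blast)
qed

text \<open>A copy counted for both \<open>f\<close> and \<open>g\<close> would send
  \<open>(x, y)\<close> to an arc of both images, so the families belonging to different members of
  \<open>F\<close> are disjoint.\<close>

lemma linear_removal_if_forcing:
  fixes H :: "'a pair_pre_digraph" and \<gamma> \<gamma>' :: real
  assumes H: "pair_graph H" and xy: "(x, y) \<in> parcs H" and force: "forcing H \<gamma>' x y"
    and \<gamma>: "0 \<le> \<gamma>'" "\<gamma>' < \<gamma>" "\<gamma> \<le> 1"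
  shows "linear_removal H \<gamma>"
proof -
  note HF = pair_graph_arcs[OF H]
  define h where "h = card (pverts H)"
  have xW: "x \<in> pverts H" "y \<in> pverts H" "x \<noteq> y" using xy HF by (auto simp: irrefl_def)
  have h2: "2 \<le> h"
  proof -
    have "card {x, y} \<le> card (pverts H)" using xW HF by (intro card_mono) auto
    then show ?thesis using xW by (simp add: h_def)
  qed
  obtain d n0 where d: "d > 0" and
    key: "\<And>(G :: nat pair_pre_digraph) f. f \<in> copies H G \<Longrightarrow> pair_graph G \<Longrightarrow> n0 \<le> card (pverts G) \<Longrightarrow>
      min_degree_ge G (\<gamma> * real (card (pverts G))) \<Longrightarrow>
      d * real (card (pverts G)) ^ card (pverts H) \<le> real (card (copies H G)) \<or>
      d * real (card (pverts G)) ^ (card (pverts H) - 2)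
      \<le> real (card {g \<in> copies H G. \<exists>(u, v)\<in>parcs H. g x = f u \<and> g y = f v})"
    using copies_through_arc_or_everywhere[OF assms] by meson
  \<comment> \<open>The second bound settles nonempty hosts with fewer than \<open>n0\<close>
    vertices, for which a single copy is already enough.\<close>
  define \<mu> where "\<mu> = min (min d 1) (1 / (real n0 + 1) ^ h)"
  have \<mu>: "0 < \<mu>" "\<mu> \<le> 1" "\<mu> \<le> d" "\<mu> \<le> 1 / (real n0 + 1) ^ h" using d by (auto simp: \<mu>_def)
  have "removal_bound \<epsilon> H \<gamma> (\<mu> * \<epsilon>)" if \<epsilon>: "0 < \<epsilon>" "\<epsilon> \<le> 1" for \<epsilon>
    unfolding removal_bound_def
  proof (intro allI impI, elim conjE exE)
    fix G :: "nat pair_pre_digraph" and n F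
    assume G: "pair_graph G" and n: "card (pverts G) = n" and deg: "min_degree_ge G (\<gamma> * real n)"
      and F: "edge_disjoint_copies H G F" and Fn: "\<epsilon> * real n ^ 2 \<le> real (card F)"
    note GF = pair_graph_arcs[OF G]
    have finC: "finite (copies H G)" by (rule finite_copies[OF HF(1) GF(1)])
    have FC: "F \<subseteq> copies H G" using F by (simp add: edge_disjoint_copies_def)
    have finF: "finite F" using FC finC finite_subset by blast
    show "\<mu> * \<epsilon> * real n ^ card (pverts H) \<le> real (card (copies H G))"
    proof (cases "n = 0")
      case True
      have "card (pverts H) \<noteq> 0" using h2 by (simp add: h_def)
      then have "real n ^ card (pverts H) = 0" using True by (simp only: of_nat_0 power_eq_0_iff) simp
      then show ?thesis by (simp only: mult_zero_right of_nat_0_le_iff)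
    next
      case n0': False
      then have "0 < \<epsilon> * real n ^ 2" using \<epsilon> by simp
      then have "0 < real (card F)" using Fn by linarith
      then have Fne: "F \<noteq> {}" by auto
      show ?thesis
      proof (cases "n0 \<le> n")
        case False
        have "\<mu> * \<epsilon> * real n ^ h \<le> \<mu> * 1 * (real n0 + 1) ^ h"
          using \<mu> \<epsilon> False by (intro mult_mono power_mono) auto
        also have "\<dots> \<le> 1 / (real n0 + 1) ^ h * (real n0 + 1) ^ h" using \<mu> by (intro mult_right_mono) auto
        also have "\<dots> = 1" by (simp add: add_eq_0_iff)
        also have "1 \<le> real (card (copies H G))"
        proof -
          have "copies H G \<noteq> {}" using Fne FC by blast
          then have "0 < card (copies H G)" using finC by (simp add: card_gt_0_iff)
          then show ?thesis by simp
        qed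
        finally show ?thesis by (simp add: h_def)
      next
        case True
        define C where "C f = {g \<in> copies H G. \<exists>(u, v)\<in>parcs H. g x = f u \<and> g y = f v}" for f
        have alt: "d * real n ^ h \<le> real (card (copies H G)) \<or> d * real n ^ (h - 2) \<le> real (card (C f))"
          if "f \<in> F" for f
          using key[of f G] that FC G True deg n by (auto simp: h_def C_def)
        have \<mu>\<epsilon>: "\<mu> * \<epsilon> \<le> d * \<epsilon>" using \<mu> \<epsilon> by (intro mult_right_mono) auto
        show ?thesis
        proof (cases "d * real n ^ h \<le> real (card (copies H G))")
          case True
          have "\<mu> * \<epsilon> * real n ^ h \<le> d * 1 * real n ^ h" using \<mu> \<epsilon> d by (intro mult_right_mono mult_mono) auto
          then show ?thesis using True by (simp add: h_def)
        next
          case False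
          have disj: "C f \<inter> C g = {}" if "f \<in> F" "g \<in> F" "f \<noteq> g" for f g
          proof (rule ccontr)
            assume "C f \<inter> C g \<noteq> {}"
            then obtain k u v u' v' where "(u, v) \<in> parcs H" "(u', v') \<in> parcs H"
              "k x = f u" "k y = f v" "k x = g u'" "k y = g v'" by (auto simp: C_def)
            then have "(k x, k y) \<in> map_prod f f ` parcs H" "(k x, k y) \<in> map_prod g g ` parcs H"
              by (force simp: image_iff)+
            moreover have "disjnt (map_prod f f ` parcs H) (map_prod g g ` parcs H)"
              using F that by (auto simp: edge_disjoint_copies_def pairwise_def)
            ultimately show False by (meson disjnt_iff)
          qed
          have "\<mu> * \<epsilon> * real n ^ h \<le> d * \<epsilon> * real n ^ h" by (rule mult_right_mono[OF \<mu>\<epsilon>]) simp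
          also have "\<dots> = \<epsilon> * real n ^ 2 * (d * real n ^ (h - 2))"
          proof -
            have "real n ^ h = real n ^ 2 * real n ^ (h - 2)"
              using h2 by (metis le_add_diff_inverse power_add)
            then show ?thesis by simp
          qed
          also have "\<dots> \<le> real (card F) * (d * real n ^ (h - 2))" using Fn d by (intro mult_right_mono) auto
          also have "\<dots> = (\<Sum>f\<in>F. d * real n ^ (h - 2))" by simp
          also have "\<dots> \<le> (\<Sum>f\<in>F. real (card (C f)))" using alt False by (intro sum_mono) blast
          also have "\<dots> = real (card (\<Union>f\<in>F. C f))"
            using finF finC disj by (subst card_UN_disjoint) (auto simp: C_def)
          also have "\<dots> \<le> real (card (copies H G))"
            using finC by (intro of_nat_mono card_mono) (auto simp: C_def)
          finally show ?thesis by (simp add: h_def)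
        qed
      qed
    qed
  qed
  moreover have "\<mu> * \<epsilon> \<in> {0..1}" if "0 < \<epsilon>" "\<epsilon> \<le> 1" for \<epsilon>
    using that \<mu> mult_mono[of \<mu> 1 \<epsilon> 1] by auto
  ultimately show ?thesis
    unfolding linear_removal_def using \<mu>(1) removal_delta_is_maximum(2) by blast
qed

section \<open>Colourings and forcing\<close>

lemma ex_proper_colouring:
  assumes "pair_graph H"
  shows "\<exists>k c. proper_colouring H k c"
proof -
  note HF = pair_graph_arcs[OF assms]
  obtain c where c: "bij_betw c (pverts H) {0..<card (pverts H)}"
    using ex_bij_betw_finite_nat[OF HF(1)] by blast
  have "proper_colouring H (card (pverts H)) c"
    unfolding proper_colouring_def
  proof (intro conjI ballI)
    show "c \<in> pverts H \<rightarrow> {..<card (pverts H)}" using c by (auto simp: bij_betw_def)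
    fix e assume e: "e \<in> parcs H"
    show "case e of (x, y) \<Rightarrow> c x \<noteq> c y"
      using e HF(3,4) bij_betw_imp_inj_on[OF c] by (auto simp: irrefl_def dest: inj_onD)
  qed
  then show ?thesis by blast
qed

lemma proper_colouringD:
  assumes "proper_colouring H k c"
  shows "p \<in> pverts H \<Longrightarrow> c p < k" "(p, q) \<in> parcs H \<Longrightarrow> c p \<noteq> c q"
  using assms by (auto simp: proper_colouring_def)

lemma chromatic_number_colouring:
  "\<exists>k c. proper_colouring H k c \<Longrightarrow> \<exists>c. proper_colouring H (chromatic_number H) c"
  unfolding chromatic_number_def by (rule LeastI_ex)

lemma chromatic_number_le: "proper_colouring H k c \<Longrightarrow> chromatic_number H \<le> k"
  unfolding chromatic_number_def by (rule Least_le) blast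

text \<open>Stated for a set of remaining arcs, so that it covers both \<open>H\<close> itself and
  \<open>H\<close> without an edge; colourings in \<open>bool\<close> are easy to complement on a
  component.\<close>

lemma chromatic_number_le_2_iff:
  fixes H :: "'a pair_pre_digraph"
  assumes "pair_graph H" "E \<subseteq> parcs H"
  shows "chromatic_number (H\<lparr>parcs := E\<rparr>) \<le> 2 \<longleftrightarrow> (\<exists>col :: 'a \<Rightarrow> bool. \<forall>(p, q)\<in>E. col p \<noteq> col q)"
    (is "?L \<longleftrightarrow> ?R")
proof
  assume L: ?L
  obtain k c where "proper_colouring H k c" using ex_proper_colouring[OF assms(1)] by blast
  then have "proper_colouring (H\<lparr>parcs := E\<rparr>) k c" using assms(2) by (auto simp: proper_colouring_def)
  then obtain c where c: "proper_colouring (H\<lparr>parcs := E\<rparr>) (chromatic_number (H\<lparr>parcs := E\<rparr>)) c"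
    using chromatic_number_colouring by blast
  have "(c p = 0) \<noteq> (c q = 0)" if "(p, q) \<in> E" for p q
  proof -
    have "p \<in> pverts H" "q \<in> pverts H" using that assms(2) pair_graph_arcs(3)[OF assms(1)] by auto
    then have "c p < 2" "c q < 2" "c p \<noteq> c q"
      using proper_colouringD(1)[OF c, of p] proper_colouringD(1)[OF c, of q] proper_colouringD(2)[OF c, of p q] L that
      by auto
    then show ?thesis by auto
  qed
  then show ?R by (intro exI[of _ "\<lambda>p. c p = 0"]) auto
next
  assume ?R
  then obtain col :: "'a \<Rightarrow> bool" where "\<forall>(p, q)\<in>E. col p \<noteq> col q" ..
  then have "proper_colouring (H\<lparr>parcs := E\<rparr>) 2 (\<lambda>p. of_bool (col p))"
    by (auto simp: proper_colouring_def)
  then show ?L by (rule chromatic_number_le)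
qed

lemma not_two_colourable:
  assumes "pair_graph H" "chromatic_number H = 3" "\<And>p q. (p, q) \<in> parcs H \<Longrightarrow> col p \<noteq> (col q :: bool)"
  shows False
proof -
  have "chromatic_number (H\<lparr>parcs := parcs H\<rparr>) \<le> 2"
    using assms by (subst chromatic_number_le_2_iff) auto
  then show False using assms(2) by simp
qed

lemma critical_edge_iff:
  fixes H :: "'a pair_pre_digraph"
  assumes "pair_graph H" "chromatic_number H = 3"
  shows "critical_edge H x y \<longleftrightarrow> (x, y) \<in> parcs H \<and>
    (\<exists>col :: 'a \<Rightarrow> bool. \<forall>(p, q)\<in>parcs H - {(x, y), (y, x)}. col p \<noteq> col q)"
proof -
  have "chromatic_number (delete_edge H x y) < chromatic_number H \<longleftrightarrow> chromatic_number (delete_edge H x y) \<le> 2"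
    using assms(2) by auto
  then show ?thesis
    unfolding critical_edge_def delete_edge_def by (subst (asm) chromatic_number_le_2_iff) (use assms in auto)
qed

lemma critical_edge_same_colour:
  assumes H: "pair_graph H" "chromatic_number H = 3"
    and col: "\<forall>(p, q)\<in>parcs H - {(x, y), (y, x)}. col p \<noteq> (col q :: bool)"
  shows "col x = col y"
proof (rule ccontr)
  assume "col x \<noteq> col y"
  then have "col p \<noteq> col q" if "(p, q) \<in> parcs H" for p q using col that by auto
  then show False using not_two_colourable[OF H] by blast
qed

lemma odd_girth_triangle:
  assumes H: "pair_graph H" and "odd_girth H \<ge> 5"
  shows "\<not> contains_triangle H"
proof
  assume "contains_triangle H"
  then obtain x y z where a: "(x, y) \<in> parcs H" "(y, z) \<in> parcs H" "(z, x) \<in> parcs H"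
    by (auto simp: contains_triangle_def)
  interpret pair_graph H by fact
  have ne: "x \<noteq> y" "y \<noteq> z" "z \<noteq> x" using a no_loops' by auto
  have "cycle [(x, y), (y, z), (z, x)]"
    using a ne wellformed' unfolding cycle_def awalk_def by auto
  then have "odd_girth H \<le> enat (length [(x, y), (y, z), (z, x)])"
    unfolding odd_girth_def by (intro INF_lower) auto
  with assms(2) have "enat 5 \<le> enat 3" by (metis numeral_eq_enat order_trans length_Cons list.size(3) numeral_3_eq_3)
  then show False by simp
qed

text \<open>A proper 3-colouring is a homomorphism to a triangle, and the ends of any edge of the
  sample have intersecting neighbourhoods.\<close>

lemma forcing_half:
  assumes H: "pair_graph H" "chromatic_number H = 3" and xy: "(x, y) \<in> parcs H"
  shows "forcing H (1 / 2) x y"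
  unfolding forcing_def
proof (intro allI impI disjI1)
  fix m :: nat and Q :: "nat rel" and S :: "'a \<Rightarrow> nat set"
  assume Q: "Q \<subseteq> {..<m} \<times> {..<m}" "sym Q" "irrefl Q"
    and deg: "\<forall>i<m. 1 / 2 * real m < real (card (Q `` {i}))"
    and S: "\<forall>v\<in>pverts H. S v \<subseteq> {..<m} \<and> 1 / 2 * real m < real (card (S v))"
  note HF = pair_graph_arcs[OF H(1)]
  have "x \<in> pverts H" using xy HF by auto
  \<comment> \<open>A vertex of \<open>H\<close> has a nonempty set \<open>S\<close>, which excludes
    the empty sample.\<close>
  then have m: "0 < m" using S by (cases m) force+
  have nbr: "Q `` {i} \<subseteq> {..<m}" "finite (Q `` {i})" for i
    using Q by (auto intro: finite_subset[of _ "{..<m}"])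
  have "Q `` {0} \<noteq> {}"
  proof
    assume "Q `` {0} = {}"
    then show False using deg m by fastforce
  qed
  then obtain j where j: "(0, j) \<in> Q" by auto
  have "Q `` {0} \<inter> Q `` {j} \<noteq> {}"
  proof
    assume "Q `` {0} \<inter> Q `` {j} = {}"
    then have "card (Q `` {0}) + card (Q `` {j}) = card (Q `` {0} \<union> Q `` {j})"
      using nbr by (intro card_Un_disjoint[symmetric]) auto
    also have "\<dots> \<le> card {..<m}" using nbr by (intro card_mono) auto
    finally have "real (card (Q `` {0})) + real (card (Q `` {j})) \<le> real m" by simp
    moreover have "1 / 2 * real m < real (card (Q `` {0}))" "1 / 2 * real m < real (card (Q `` {j}))"
      using deg m j Q by auto
    ultimately show False by simp
  qed
  then obtain l where l: "(0, l) \<in> Q" "(j, l) \<in> Q" by auto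
  have sym: "(j, 0) \<in> Q" "(l, 0) \<in> Q" "(l, j) \<in> Q" using j l Q(2) by (auto dest: symD)
  obtain c where c: "proper_colouring H 3 c"
    using chromatic_number_colouring[OF ex_proper_colouring[OF H(1)]] H(2) by auto
  define \<phi> where "\<phi> p = (if c p = 0 then 0 else if c p = 1 then j else l)" for p
  have "(\<phi> p, \<phi> q) \<in> Q" if "(p, q) \<in> parcs H" for p q
  proof -
    have "p \<in> pverts H" "q \<in> pverts H" using that HF by auto
    then have "c p < 3" "c q < 3" "c p \<noteq> c q" using proper_colouringD[OF c] that by auto
    then show ?thesis using j l sym by (auto simp: \<phi>_def)
  qed
  moreover have "j < m" "l < m" using j l Q by auto
  then have "\<phi> \<in> pverts H \<rightarrow> {..<m}" using m by (simp add: \<phi>_def)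
  ultimately show "\<exists>\<phi>\<in>pverts H \<rightarrow> {..<m}. \<forall>(p, q)\<in>parcs H. (\<phi> p, \<phi> q) \<in> Q" by blast
qed

text \<open>Three sets above a third cannot be pairwise disjoint, so the ends of some edge of the
  triangle share a sampled neighbour \<open>s\<close>. The 2-colouring of \<open>H - xy\<close> then
  folds all vertices other than \<open>x\<close> and \<open>y\<close> onto one edge at
  \<open>s\<close>.\<close>

lemma forcing_third:
  assumes H: "pair_graph H" "chromatic_number H = 3" and crit: "critical_edge H x y"
    and tri: "contains_triangle H"
  shows "forcing H (1 / 3) x y"
  unfolding forcing_def
proof (intro allI impI disjI2)
  fix m :: nat and Q :: "nat rel" and S :: "'a \<Rightarrow> nat set"
  assume Q: "Q \<subseteq> {..<m} \<times> {..<m}" "sym Q" "irrefl Q"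
    and deg: "\<forall>i<m. 1 / 3 * real m < real (card (Q `` {i}))"
    and S: "\<forall>v\<in>pverts H. S v \<subseteq> {..<m} \<and> 1 / 3 * real m < real (card (S v))"
  note HF = pair_graph_arcs[OF H(1)]
  obtain col :: "'a \<Rightarrow> bool" where xy: "(x, y) \<in> parcs H"
    and col: "\<forall>(p, q)\<in>parcs H - {(x, y), (y, x)}. col p \<noteq> col q"
    using crit critical_edge_iff[OF H] by blast
  have same: "col x = col y" by (rule critical_edge_same_colour[OF H col])
  obtain a b c where t: "(a, b) \<in> parcs H" "(b, c) \<in> parcs H" "(c, a) \<in> parcs H"
    using tri by (auto simp: contains_triangle_def)
  then have abc: "a \<in> pverts H" "b \<in> pverts H" "c \<in> pverts H" using HF by auto
  have "\<exists>(u, v)\<in>parcs H. S u \<inter> S v \<noteq> {}"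
  proof (rule ccontr)
    assume "\<not> ?thesis"
    then have disj: "S u \<inter> S v = {}" if "(u, v) \<in> parcs H" for u v using that by blast
    have fin: "finite (S a)" "finite (S b)" "finite (S c)"
      using S abc by (auto intro: finite_subset[of _ "{..<m}"])
    have "card (S a) + card (S b) + card (S c) = card (S a \<union> S b \<union> S c)"
      using fin disj[OF t(1)] disj[OF t(2)] disj[OF t(3)]
      by (subst card_Un_disjoint, auto)+
    also have "\<dots> \<le> card {..<m}" using S abc by (intro card_mono) auto
    finally have "real (card (S a)) + real (card (S b)) + real (card (S c)) \<le> real m" by simp
    moreover have "1 / 3 * real m < real (card (S a))" "1 / 3 * real m < real (card (S b))" "1 / 3 * real m < real (card (S c))"
      using S abc by auto
    ultimately show False by simp
  qed
  then obtain u v s where uv: "(u, v) \<in> parcs H" and s: "s \<in> S u" "s \<in> S v" by blast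
  have "u \<in> pverts H" using uv HF by auto
  then have sm: "s < m" using s S by blast
  have "Q `` {s} \<noteq> {}"
  proof
    assume "Q `` {s} = {}"
    then show False using deg sm by fastforce
  qed
  then obtain w where w: "(s, w) \<in> Q" "(w, s) \<in> Q" using Q(2) by (auto dest: symD)
  \<comment> \<open>Neighbours of \<open>x\<close> and \<open>y\<close> have the colour opposite to
    both, so they go to the common neighbour \<open>s\<close>.\<close>
  define \<phi> where "\<phi> p = (if col p = col x then w else s)" for p
  have "w < m" using w Q by auto
  then have "\<phi> \<in> pverts H - {x, y} \<rightarrow> {..<m}" using sm by (simp add: \<phi>_def)
  moreover have "(\<phi> p, \<phi> q) \<in> Q" if "(p, q) \<in> parcs H" "p \<notin> {x, y}" "q \<notin> {x, y}" for p q
  proof -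
    have "col p \<noteq> col q" using col that by auto
    then show ?thesis using w by (auto simp: \<phi>_def)
  qed
  moreover have "\<phi> p = s" if "p \<notin> {x, y}" "(x, p) \<in> parcs H \<or> (y, p) \<in> parcs H" for p
  proof -
    have "col p \<noteq> col x" using col that same by auto
    then show ?thesis by (simp add: \<phi>_def)
  qed
  ultimately show "\<exists>(u, v)\<in>parcs H. \<exists>\<phi>\<in>pverts H - {x, y} \<rightarrow> {..<m}.
        (\<forall>(p, q)\<in>parcs H. p \<notin> {x, y} \<longrightarrow> q \<notin> {x, y} \<longrightarrow> (\<phi> p, \<phi> q) \<in> Q) \<and>
        (\<forall>p\<in>pverts H - {x, y}. ((x, p) \<in> parcs H \<longrightarrow> \<phi> p \<in> S u) \<and> ((y, p) \<in> parcs H \<longrightarrow> \<phi> p \<in> S v))"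
    using uv s by (intro bexI[of _ "(u, v)"]) (auto intro!: bexI[of _ \<phi>])
qed

text \<open>
  The levels of \<open>H - xy\<close> by distance from \<open>x\<close>, folded back at the level \<open>2k\<close> of \<open>y\<close>, map \<open>H\<close> onto any
  closed walk of length \<open>2k + 1\<close>.
\<close>

lemma odd_cycle_through_critical_edge:
  fixes H :: "'a pair_pre_digraph"
  assumes H: "pair_graph H" "chromatic_number H = 3" and xy: "(x, y) \<in> parcs H"
    and col: "\<forall>(p, q)\<in>parcs H - {(x, y), (y, x)}. col p \<noteq> (col q :: bool)" and tri: "\<not> contains_triangle H"
  obtains k f F where "2 \<le> k" "f 0 = x" "f (2 * k) = y" "\<And>i. i < 2 * k \<Longrightarrow> (f i, f (Suc i)) \<in> parcs H"
    and "\<And>p. F p \<le> 2 * k" and "\<And>p q. (p, q) \<in> parcs H \<Longrightarrow>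
      F p = Suc (F q) \<or> F q = Suc (F p) \<or> F p = 0 \<and> F q = 2 * k \<or> F q = 0 \<and> F p = 2 * k"
proof -
  note HF = pair_graph_arcs[OF H(1)]
  have same: "col x = col y" by (rule critical_edge_same_colour[OF H col])
  define D where "D = parcs H - {(x, y), (y, x)}"
  have Dsym: "(q, p) \<in> D" if "(p, q) \<in> D" for p q using that HF(5) by (auto simp: D_def)
  have Dcol: "col p \<noteq> col q" if "(p, q) \<in> D" for p q using that col by (auto simp: D_def)
  have reach: "(x, q) \<in> D\<^sup>*" if "(x, p) \<in> D\<^sup>*" "(p, q) \<in> D" for p q
    using that by (rule rtrancl_into_rtrancl)
  \<comment> \<open>Otherwise \<open>y\<close> lies outside the component of \<open>x\<close> in
    \<open>H - xy\<close>, and complementing the colours off that component would 2-colour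
    \<open>H\<close>.\<close>
  have xy_reach: "(x, y) \<in> D\<^sup>*"
  proof (rule ccontr)
    assume n: "(x, y) \<notin> D\<^sup>*"
    define c where "c p \<longleftrightarrow> (col p \<longleftrightarrow> (x, p) \<in> D\<^sup>*)" for p
    have "c p \<noteq> c q" if "(p, q) \<in> parcs H" for p q
    proof (cases "(p, q) \<in> D")
      case True
      then have "(x, p) \<in> D\<^sup>* \<longleftrightarrow> (x, q) \<in> D\<^sup>*" using reach Dsym by blast
      then show ?thesis using Dcol[OF True] by (auto simp: c_def)
    next
      case False
      then have "(p, q) = (x, y) \<or> (p, q) = (y, x)" using that by (auto simp: D_def)
      then show ?thesis using n same by (auto simp: c_def)
    qed
    then show False using not_two_colourable[OF H] by blast
  qed
  have parity: "col p = col x \<longleftrightarrow> even n" if "(x, p) \<in> D ^^ n" for p n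
    using that
  proof (induction n arbitrary: p)
    case (Suc n)
    then obtain q where "(x, q) \<in> D ^^ n" "(q, p) \<in> D" by auto
    then show ?case using Suc.IH[of q] Dcol[of q p] by auto
  qed auto
  define d where "d p = (LEAST n. (x, p) \<in> D ^^ n)" for p
  have d: "(x, p) \<in> D ^^ d p" if "(x, p) \<in> D\<^sup>*" for p
    unfolding d_def by (rule LeastI_ex) (use that in \<open>simp add: rtrancl_power\<close>)
  have d_le: "d p \<le> n" if "(x, p) \<in> D ^^ n" for p n
    unfolding d_def using that by (rule Least_le)
  have "even (d y)" using parity[OF d[OF xy_reach]] same by simp
  then obtain k where k: "d y = 2 * k" by blast
  have "k \<noteq> 0"
  proof
    assume "k = 0"
    then have "x = y" using d[OF xy_reach] k by simp
    then show False using xy HF by (auto simp: irrefl_def)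
  qed
  moreover have "k \<noteq> 1"
  proof
    assume "k = 1"
    then have "(x, y) \<in> D ^^ 2" using d[OF xy_reach] k by simp
    then obtain z where "(x, z) \<in> parcs H" "(z, y) \<in> parcs H" by (auto simp: D_def numeral_2_eq_2)
    then show False using tri xy HF(5) unfolding contains_triangle_def by blast
  qed
  ultimately have k2: "2 \<le> k" by simp
  obtain f where f: "f 0 = x" "f (2 * k) = y" "\<And>i. i < 2 * k \<Longrightarrow> (f i, f (Suc i)) \<in> D"
    using d[OF xy_reach] unfolding k relpow_fun_conv by blast
  \<comment> \<open>Vertices not reachable from \<open>x\<close> get the level \<open>2 * k\<close>
    or \<open>2 * k + 1\<close> by colour, so that levels still differ by one along every arc of
    \<open>D\<close>.\<close>
  define e where "e p = (if (x, p) \<in> D\<^sup>* then d p else if col p = col x then 2 * k else 2 * k + 1)" for p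
  \<comment> \<open>Beyond \<open>2 * k\<close> the levels alternate between
    \<open>2 * k - 1\<close> and \<open>2 * k\<close>, which preserves differences of one.\<close>
  define F where "F p = (if e p \<le> 2 * k then e p else if even (e p) then 2 * k else 2 * k - 1)" for p
  have e_step: "e p = Suc (e q) \<or> e q = Suc (e p)" if pq: "(p, q) \<in> D" for p q
  proof (cases "(x, p) \<in> D\<^sup>*")
    case True
    then have q: "(x, q) \<in> D\<^sup>*" using reach pq by blast
    have "d q \<le> Suc (d p)" using d_le[of q "Suc (d p)"] d[OF True] pq by auto
    moreover have "d p \<le> Suc (d q)" using d_le[of p "Suc (d q)"] d[OF q] Dsym[OF pq] by auto
    moreover have "d p \<noteq> d q"
      using parity[OF d[OF True]] parity[OF d[OF q]] Dcol[OF pq] by auto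
    ultimately show ?thesis using True q by (auto simp: e_def)
  next
    case False
    then have "(x, q) \<notin> D\<^sup>*" using reach Dsym[OF pq] by blast
    then show ?thesis using False Dcol[OF pq] by (auto simp: e_def)
  qed
  show thesis
  proof (rule that[OF k2 f(1,2)])
    show "(f i, f (Suc i)) \<in> parcs H" if "i < 2 * k" for i using f(3)[OF that] by (simp add: D_def)
    show "F p \<le> 2 * k" for p by (auto simp: F_def)
    fix p q assume pq: "(p, q) \<in> parcs H"
    show "F p = Suc (F q) \<or> F q = Suc (F p) \<or> F p = 0 \<and> F q = 2 * k \<or> F q = 0 \<and> F p = 2 * k"
    proof (cases "(p, q) \<in> D")
      case True
      have "F a = Suc (F b) \<or> F b = Suc (F a)" if "e a = Suc (e b)" for a b
      proof (cases "e b < 2 * k")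
        case True
        then show ?thesis using that by (simp add: F_def)
      next
        case False
        then show ?thesis using that k2 by (cases "e b = 2 * k") (auto simp: F_def)
      qed
      then show ?thesis using e_step[OF True] by blast
    next
      case False
      have "d x = 0" using d_le[of x 0] by simp
      then have "F x = 0" "F y = 2 * k" using xy_reach k by (auto simp: F_def e_def)
      then show ?thesis using False pq by (auto simp: D_def)
    qed
  qed
qed

text \<open>If the sample has a closed walk of length \<open>2 * k + 1\<close>, then
  \<open>H\<close> folds onto it through \<open>F\<close>. Otherwise the sampled neighbour sets
  along the odd cycle of \<open>f\<close> are linked at some edge \<open>uv\<close>, which yields a
  walk \<open>u, a, w, b, v\<close>.\<close>

lemma forcing_quarter:
  assumes H: "pair_graph H" "chromatic_number H = 3" and crit: "critical_edge H x y"
    and tri: "\<not> contains_triangle H"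
  shows "forcing H (1 / 4) x y"
  unfolding forcing_def
proof (intro allI impI)
  fix m :: nat and Q :: "nat rel" and S :: "'a \<Rightarrow> nat set"
  assume Q: "Q \<subseteq> {..<m} \<times> {..<m}" "sym Q" "irrefl Q"
    and deg: "\<forall>i<m. 1 / 4 * real m < real (card (Q `` {i}))"
    and S: "\<forall>v\<in>pverts H. S v \<subseteq> {..<m} \<and> 1 / 4 * real m < real (card (S v))"
  note HF = pair_graph_arcs[OF H(1)]
  obtain col :: "'a \<Rightarrow> bool" where xy: "(x, y) \<in> parcs H"
    and col: "\<forall>(p, q)\<in>parcs H - {(x, y), (y, x)}. col p \<noteq> col q"
    using crit critical_edge_iff[OF H] by blast
  have same: "col x = col y" by (rule critical_edge_same_colour[OF H col])
  obtain k f F where k: "2 \<le> k" and f: "f 0 = x" "f (2 * k) = y" "\<And>i. i < 2 * k \<Longrightarrow> (f i, f (Suc i)) \<in> parcs H"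
    and F: "\<And>p. F p \<le> 2 * k" "\<And>p q. (p, q) \<in> parcs H \<Longrightarrow>
      F p = Suc (F q) \<or> F q = Suc (F p) \<or> F p = 0 \<and> F q = 2 * k \<or> F q = 0 \<and> F p = 2 * k"
    by (rule odd_cycle_through_critical_edge[OF H xy col tri]) (rule that)
  interpret quarter_dense "{..<m}" Q
  proof
    fix v assume "v \<in> {..<m}"
    then have "1 / 4 * real m < real (card (Q `` {v}))" using deg by simp
    then show "card {..<m} < 4 * card (Q `` {v})" by simp
  qed (use Q in auto)
  let ?hom = "\<exists>\<phi>\<in>pverts H \<rightarrow> {..<m}. \<forall>(p, q)\<in>parcs H. (\<phi> p, \<phi> q) \<in> Q"
  let ?ext = "\<exists>(u, v)\<in>parcs H. \<exists>\<phi>\<in>pverts H - {x, y} \<rightarrow> {..<m}.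
        (\<forall>(p, q)\<in>parcs H. p \<notin> {x, y} \<longrightarrow> q \<notin> {x, y} \<longrightarrow> (\<phi> p, \<phi> q) \<in> Q) \<and>
        (\<forall>p\<in>pverts H - {x, y}. ((x, p) \<in> parcs H \<longrightarrow> \<phi> p \<in> S u) \<and> ((y, p) \<in> parcs H \<longrightarrow> \<phi> p \<in> S v))"
  show "?hom \<or> ?ext"
  proof (cases "\<exists>a. (a, a) \<in> Q ^^ (2 * k + 1)")
    case True
    then obtain w where w: "w 0 = w (2 * k + 1)" "\<And>i. i < 2 * k + 1 \<Longrightarrow> (w i, w (Suc i)) \<in> Q"
      unfolding relpow_fun_conv by metis
    have "(w (F p), w (F q)) \<in> Q" if pq: "(p, q) \<in> parcs H" for p q
    proof -
      have step: "(w i, w (Suc i)) \<in> Q" "(w (Suc i), w i) \<in> Q" if "i \<le> 2 * k" for i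
        using w(2)[of i] that by (auto intro: Q_sym)
      have close: "(w (2 * k), w 0) \<in> Q" "(w 0, w (2 * k)) \<in> Q" using step[of "2 * k"] w(1) by auto
      show ?thesis using F(2)[OF pq] F(1)[of p] F(1)[of q] step close by auto
    qed
    moreover have "(\<lambda>p. w (F p)) \<in> pverts H \<rightarrow> {..<m}"
    proof
      fix p
      have "(w (F p), w (Suc (F p))) \<in> Q" using w(2)[of "F p"] F(1)[of p] by simp
      then show "w (F p) \<in> {..<m}" using Q by auto
    qed
    ultimately have ?hom by (intro bexI[of _ "\<lambda>p. w (F p)"]) auto
    then show ?thesis ..
  next
    case False
    have fH: "f i \<in> pverts H" if "i \<le> 2 * k" for i
    proof (cases "i = 2 * k")
      case True
      then show ?thesis using f(2) xy HF by auto
    next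
      case False
      then have "(f i, f (Suc i)) \<in> parcs H" using that by (intro f(3)) simp
      then show ?thesis using HF by auto
    qed
    have "S (f i) \<subseteq> {..<m} \<and> card {..<m} < 4 * card (S (f i))" if "i \<le> 2 * k" for i
    proof -
      have "1 / 4 * real m < real (card (S (f i)))" using S fH[OF that] by blast
      then show ?thesis using S fH[OF that] by auto
    qed
    then obtain i where i: "i \<le> 2 * k" and meet: "Q `` S (f i) \<inter> Q `` S (f (Suc i mod (2 * k + 1))) \<noteq> {}"
      using linked_consecutive_sets[OF k, of "\<lambda>i. S (f i)"] False by blast
    define u v where "u = f i" and "v = f (Suc i mod (2 * k + 1))"
    have uv: "(u, v) \<in> parcs H"
    proof (cases "i = 2 * k")
      case True
      then show ?thesis using f xy HF(5) by (simp add: u_def v_def)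
    next
      case False
      then show ?thesis using f(3)[of i] i by (simp add: u_def v_def)
    qed
    from meet obtain w a b where ab: "a \<in> S u" "(a, w) \<in> Q" "b \<in> S v" "(b, w) \<in> Q"
      unfolding u_def v_def by blast
    have wab: "(w, a) \<in> Q" "(w, b) \<in> Q" using ab Q_sym by auto
    \<comment> \<open>Neighbours of \<open>x\<close> go to \<open>a\<close> and neighbours of
      \<open>y\<close> to \<open>b\<close>; this is consistent because a common neighbour would form
      a triangle with \<open>xy\<close>.\<close>
    define \<phi> where "\<phi> p = (if col p = col x then w else if (x, p) \<in> parcs H then a else b)" for p
    have "w < m" "a < m" "b < m" using ab Q by auto
    then have "\<phi> \<in> pverts H - {x, y} \<rightarrow> {..<m}" by (simp add: \<phi>_def)
    moreover have "(\<phi> p, \<phi> q) \<in> Q" if "(p, q) \<in> parcs H" "p \<notin> {x, y}" "q \<notin> {x, y}" for p q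
    proof -
      have "col p \<noteq> col q" using col that by auto
      then show ?thesis using ab wab by (auto simp: \<phi>_def)
    qed
    moreover have "\<phi> p \<in> S u" if "p \<notin> {x, y}" "(x, p) \<in> parcs H" for p
    proof -
      have "col p \<noteq> col x" using col that by auto
      then show ?thesis using that ab by (simp add: \<phi>_def)
    qed
    moreover have "\<phi> p \<in> S v" if "p \<notin> {x, y}" "(y, p) \<in> parcs H" for p
    proof -
      have "col p \<noteq> col x" using col that same by auto
      moreover have "(x, p) \<notin> parcs H" using tri that xy HF(5) unfolding contains_triangle_def by blast
      ultimately show ?thesis using ab by (simp add: \<phi>_def)
    qed
    ultimately have ?ext using uv by (intro bexI[of _ "(u, v)"]) (auto intro!: bexI[of _ \<phi>])
    then show ?thesis ..
  qed
qed

section \<open>Lower bounds\<close>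

text \<open>\<open>core\<close> confines \<open>g q\<close> to the block of length \<open>p\<close>
  that contains \<open>g r\<close>, at one of \<open>h\<close> positions, and likewise
  \<open>g q'\<close> to the block of \<open>g r'\<close>. So the values off \<open>q\<close> and
  \<open>q'\<close> together with two residues determine \<open>g\<close>.\<close>

lemma card_maps_two_determined_vertices:
  fixes core :: "nat \<Rightarrow> nat \<Rightarrow> bool"
  assumes fin: "finite W" and q: "q \<in> W" "q' \<in> W" "q \<noteq> q'" and r: "r \<in> W - {q, q'}" "r' \<in> W - {q, q'}"
    and core: "\<And>u v. core u v \<Longrightarrow> u div p = v div p \<and> v mod p < h"
  shows "card {g \<in> W \<rightarrow>\<^sub>E {..<n}. core (g r) (g q) \<and> core (g r') (g q')} \<le> n ^ (card W - 2) * h\<^sup>2"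
proof -
  let ?C = "{g \<in> W \<rightarrow>\<^sub>E {..<n}. core (g r) (g q) \<and> core (g r') (g q')}"
  let ?W = "W - {q, q'}"
  let ?s = "\<lambda>g :: 'a \<Rightarrow> nat. (restrict g ?W, g q mod p, g q' mod p)"
  let ?T = "(?W \<rightarrow>\<^sub>E {..<n}) \<times> {..<h} \<times> {..<h}"
  have finPi: "finite (?W \<rightarrow>\<^sub>E {..<n})" using fin by (intro finite_PiE) auto
  have "inj_on ?s ?C"
  proof (rule inj_onI)
    fix g k assume g: "g \<in> ?C" and k: "k \<in> ?C" and eq: "?s g = ?s k"
    have on: "g z = k z" if "z \<in> ?W" for z
    proof -
      have "restrict g ?W z = restrict k ?W z" using eq by simp
      then show ?thesis using that by simp
    qed
    have "g q div p = k q div p" "g q' div p = k q' div p"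
      using g k core[of "g r" "g q"] core[of "k r" "k q"] core[of "g r'" "g q'"] core[of "k r'" "k q'"] on[of r] on[of r'] r
      by auto
    then have "g q = k q" "g q' = k q'" using eq by (metis div_mult_mod_eq prod.inject)+
    then have "g z = k z" if "z \<in> W" for z using on[of z] that by (cases "z = q \<or> z = q'") auto
    then show "g = k" using g k by (auto intro: PiE_ext)
  qed
  moreover have "?s ` ?C \<subseteq> ?T"
  proof (rule image_subsetI)
    fix g assume g: "g \<in> ?C"
    then have "restrict g ?W \<in> ?W \<rightarrow>\<^sub>E {..<n}" unfolding restrict_PiE_iff by auto
    moreover have "g q mod p < h" "g q' mod p < h" using g core by blast+
    ultimately show "?s g \<in> ?T" by simp
  qed
  ultimately have "card ?C \<le> card ?T" using finPi by (intro card_inj_on_le) auto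
  also have "\<dots> = n ^ (card W - 2) * h\<^sup>2"
  proof -
    have "card ?W = card W - 2" using fin q by (simp add: card_Diff_subset)
    then show ?thesis using fin by (simp add: card_cartesian_product card_PiE power2_eq_square)
  qed
  finally show ?thesis .
qed

text \<open>
  The host consists of \<open>N\<close> disjoint copies of \<open>H\<close> and of \<open>s\<close> independent sets of size \<open>K N\<close>. The labels
  0, 1, 2 mark the colour classes of the copies, the labels \<open>3, \<dots>, s + 2\<close> mark the independent sets,
  and vertices with \<open>R\<close>-related labels are joined. A copy of \<open>H\<close> using two edges that do not come from
  \<open>R\<close> has two vertices that are determined by others up to boundedly many choices.
\<close>

lemma not_linear_removal_if_two_core_edges:
  fixes H :: "'a pair_pre_digraph" and R :: "nat rel" and \<gamma> :: real and c :: "'a \<Rightarrow> nat"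
  assumes H: "pair_graph H" and c: "proper_colouring H 3 c" and xy: "(x, y) \<in> parcs H"
    and R: "sym R" "irrefl R" and outer: "\<And>a. a < 3 + s \<Longrightarrow> \<exists>b. 3 \<le> b \<and> b < 3 + s \<and> (a, b) \<in> R"
    and two: "\<And>\<tau> p q. (p, q) \<in> parcs H \<Longrightarrow>
      (\<And>u v. (u, v) \<in> parcs H \<Longrightarrow> (u, v) \<notin> {(p, q), (q, p)} \<Longrightarrow> (\<tau> u, \<tau> v) \<in> R) \<Longrightarrow>
      (\<tau> p, \<tau> q) \<in> R \<or> (\<tau> p < 3 \<and> \<tau> q < 3 \<and> \<tau> p \<noteq> \<tau> q) \<Longrightarrow> False"
    and \<gamma>: "0 \<le> \<gamma>" "\<gamma> * real s < 1"
  shows "\<not> linear_removal H \<gamma>"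
proof
  assume "linear_removal H \<gamma>"
  then obtain \<mu> where \<mu>: "\<mu> > 0" and lin: "\<And>\<epsilon>. 0 < \<epsilon> \<Longrightarrow> \<epsilon> \<le> 1 \<Longrightarrow> \<mu> * \<epsilon> \<le> removal_delta \<epsilon> H \<gamma>"
    by (auto simp: linear_removal_def)
  note HF = pair_graph_arcs[OF H]
  define W where "W = pverts H"
  define h where "h = card W"
  have finW: "finite W" using HF by (simp add: W_def)
  have xW: "x \<in> W" "y \<in> W" "x \<noteq> y" using xy HF by (auto simp: W_def irrefl_def)
  have h2: "2 \<le> h"
  proof -
    have "card {x, y} \<le> card W" using xW finW by (intro card_mono) auto
    then show ?thesis using xW by (simp add: h_def)
  qed
  obtain e where e: "bij_betw e {0..<h} W" using ex_bij_betw_nat_finite[OF finW] by (auto simp: h_def)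
  have eW: "e i \<in> W" if "i < h" for i using that e by (auto simp: bij_betw_def)
  define e' where "e' = inv_into {0..<h} e"
  have e': "e' v < h" "e (e' v) = v" if "v \<in> W" for v
    using that e inv_into_into[of v e "{0..<h}"] f_inv_into_f[of v e "{0..<h}"] by (auto simp: e'_def bij_betw_def)
  \<comment> \<open>Every vertex sees a full run of length \<open>K\<close> in each block of length
    \<open>h + s * K\<close>; for large \<open>K\<close> this proportion approaches
    \<open>1 / s\<close>, which exceeds \<open>\<gamma>\<close>.\<close>
  obtain K :: nat where K: "\<gamma> * (real h + real s * real K) \<le> real K"
  proof -
    obtain K :: nat where "\<gamma> * real h / (1 - \<gamma> * real s) < real K" using reals_Archimedean2 by blast
    then have "\<gamma> * real h < real K * (1 - \<gamma> * real s)" using \<gamma> by (simp add: field_simps)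
    then show ?thesis using that[of K] by (simp add: algebra_simps)
  qed
  \<comment> \<open>\<open>h ^ 6\<close> is the constant in the upper bound on copies: at most
    \<open>h ^ 4\<close> choices of two core arcs and \<open>h ^ 2\<close> choices of
    residues.\<close>
  obtain N :: nat where N: "real h ^ 6 < \<mu> * real N" "0 < N"
  proof -
    obtain N :: nat where "real h ^ 6 / \<mu> < real N" using reals_Archimedean2 by blast
    then have "real h ^ 6 < \<mu> * real N" using \<mu> by (simp add: field_simps)
    moreover have "0 < N" using calculation \<mu> by (cases N) (auto simp: not_less)
    ultimately show ?thesis by (rule that)
  qed
  define p where "p = h + s * K"
  have hp: "h \<le> p" "0 < p" using h2 by (auto simp: p_def)
  define n where "n = p * N"
  have n0: "n > 0" using hp N by (simp add: n_def)
  \<comment> \<open>In each block of length \<open>p\<close> the first \<open>h\<close> positions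
    carry a copy of \<open>H\<close>, labelled by colour; the rest splits into \<open>s\<close> runs
    of length \<open>K\<close>. An independent set of the host unites the runs of one label.\<close>
  define lab where "lab i = (if i < h then c (e i) else 3 + (i - h) div K)" for i
  define core where "core u v \<longleftrightarrow> u div p = v div p \<and> u mod p < h \<and> v mod p < h \<and> (e (u mod p), e (v mod p)) \<in> parcs H" for u v
  define G where "G = \<lparr>pverts = {..<n}, parcs = {(u, v). u < n \<and> v < n \<and>
      ((lab (u mod p), lab (v mod p)) \<in> R \<or> core u v)}\<rparr>"
  have core_sym: "core v u" if "core u v" for u v using that HF(5) by (auto simp: core_def)
  have core_lab: "lab (u mod p) < 3 \<and> lab (v mod p) < 3 \<and> lab (u mod p) \<noteq> lab (v mod p)" if "core u v" for u v
    using that eW proper_colouringD[OF c] by (auto simp: core_def lab_def W_def)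
  have lab_lt: "lab (u mod p) < 3 + s" for u
  proof (cases "u mod p < h")
    case True
    then have "c (e (u mod p)) < 3" using eW proper_colouringD[OF c] by (auto simp: W_def)
    then show ?thesis using True by (simp add: lab_def)
  next
    case False
    have "u mod p < p" using hp by simp
    then have "u mod p - h < s * K" using False by (simp add: p_def)
    then show ?thesis using False by (simp add: lab_def less_mult_imp_div_less)
  qed
  have G: "pair_graph G"
  proof
    show "finite (pverts G)" by (simp add: G_def)
    have "parcs G \<subseteq> {..<n} \<times> {..<n}" by (auto simp: G_def)
    then show "finite (parcs G)" by (rule finite_subset) simp
    show "symmetric (with_proj G)"
      using R(1) core_sym by (auto simp: G_def symmetric_def sym_def)
    show "fst a \<noteq> snd a" if "a \<in> parcs G" for a
      using that R(2) HF(4) by (auto simp: G_def core_def irrefl_def)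
  qed (auto simp: G_def)
  have cG: "card (pverts G) = n" by (simp add: G_def)
  have deg: "min_degree_ge G (\<gamma> * real n)"
    unfolding min_degree_ge_def out_degree_with_proj
  proof
    fix v assume v: "v \<in> pverts G"
    \<comment> \<open>The label \<open>b\<close> contributes \<open>K\<close> neighbours in each of
      the \<open>N\<close> blocks.\<close>
    obtain b where b: "3 \<le> b" "b < 3 + s" "(lab (v mod p), b) \<in> R" using outer[OF lab_lt] by blast
    let ?z = "\<lambda>(j, i). p * j + (h + (b - 3) * K + i)"
    have small: "h + (b - 3) * K + i < p" if "i < K" for i
    proof -
      have "(b - 3) * K + i < (b - 3) * K + K" using that by simp
      also have "\<dots> = Suc (b - 3) * K" by simp
      also have "\<dots> \<le> s * K" using b by (intro mult_right_mono) auto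
      finally show ?thesis by (simp add: p_def)
    qed
    have zd: "?z (j, i) div p = j" "?z (j, i) mod p = h + (b - 3) * K + i" if "i < K" for j i
      using small[OF that] by auto
    have "inj_on ?z ({..<N} \<times> {..<K})"
    proof (rule inj_onI)
      fix a a' assume a: "a \<in> {..<N} \<times> {..<K}" "a' \<in> {..<N} \<times> {..<K}" "?z a = ?z a'"
      obtain j i j' i' where ji: "a = (j, i)" "a' = (j', i')" by (cases a, cases a')
      have iK: "i < K" "i' < K" using a ji by auto
      have "?z (j, i) div p = ?z (j', i') div p" "?z (j, i) mod p = ?z (j', i') mod p"
        using a(3) unfolding ji by (simp_all only:)
      then have "j = j'" "h + (b - 3) * K + i = h + (b - 3) * K + i'"
        by (simp_all only: zd[OF iK(1)] zd[OF iK(2)])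
      then show "a = a'" by (simp add: ji)
    qed
    moreover have "?z ` ({..<N} \<times> {..<K}) \<subseteq> parcs G `` {v}"
    proof (rule image_subsetI)
      fix a assume a: "a \<in> {..<N} \<times> {..<K}"
      obtain j i where ji: "a = (j, i)" by (cases a)
      have i: "i < K" and j: "j < N" using a ji by auto
      have "?z a < p * j + p" using small[OF i] by (simp add: ji)
      also have "\<dots> = p * Suc j" by simp
      also have "\<dots> \<le> n" unfolding n_def using j by (intro mult_left_mono) auto
      finally have "?z a < n" .
      moreover have "lab (?z a mod p) = b"
        unfolding ji zd(2)[OF i] using b i by (simp add: lab_def)
      ultimately show "?z a \<in> parcs G `` {v}" using b v by (auto simp: G_def)
    qed
    moreover have "finite (parcs G `` {v})" using pair_graph_arcs(2)[OF G] by (rule finite_Image)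
    ultimately have "card ({..<N} \<times> {..<K}) \<le> card (parcs G `` {v})" by (rule card_inj_on_le)
    then have "real N * real K \<le> real (card (parcs G `` {v}))"
      by (simp add: card_cartesian_product flip: of_nat_mult)
    moreover have "\<gamma> * real n \<le> real N * real K"
    proof -
      have "\<gamma> * real n = \<gamma> * (real h + real s * real K) * real N" by (simp add: n_def p_def)
      also have "\<dots> \<le> real K * real N" by (rule mult_right_mono[OF K]) simp
      finally show ?thesis by (simp add: mult.commute)
    qed
    ultimately show "\<gamma> * real n \<le> real (card (parcs G `` {v}))" by linarith
  qed
  define f where "f j = (\<lambda>v\<in>W. p * j + e' v)" for j
  have fdm: "f j v div p = j" "f j v mod p = e' v" if "v \<in> W" for j v
    using e'(1)[OF that] hp that by (auto simp: f_def)
  have fcopy: "f j \<in> copies H G" if j: "j < N" for j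
  proof -
    have f_lt: "f j v < n" if "v \<in> W" for v
    proof -
      have "f j v < p * j + p" using e'(1)[OF that] hp that by (simp add: f_def)
      also have "\<dots> = p * Suc j" by simp
      also have "\<dots> \<le> n" unfolding n_def using j by (intro mult_left_mono) auto
      finally show ?thesis .
    qed
    have "f j \<in> W \<rightarrow>\<^sub>E {..<n}"
    proof (rule PiE_I)
      show "f j v \<in> {..<n}" if "v \<in> W" for v using f_lt[OF that] by simp
      show "f j v = undefined" if "v \<notin> W" for v using that by (simp add: f_def)
    qed
    moreover have "inj_on (f j) W"
    proof (rule inj_onI)
      fix u v assume uv: "u \<in> W" "v \<in> W" "f j u = f j v"
      then have "e' u = e' v" using fdm(2)[of u j] fdm(2)[of v j] by simp
      then show "u = v" using e'(2) uv by metis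
    qed
    moreover have "(f j u, f j v) \<in> parcs G" if uv: "(u, v) \<in> parcs H" for u v
    proof -
      have W: "u \<in> W" "v \<in> W" using uv HF by (auto simp: W_def)
      have "core (f j u) (f j v)" using W uv fdm e' by (simp add: core_def)
      then show ?thesis using f_lt W by (simp add: G_def)
    qed
    ultimately show ?thesis by (auto simp: copies_def W_def G_def)
  qed
  define F where "F = f ` {..<N}"
  have "inj_on f {..<N}"
  proof (rule inj_onI)
    fix i j assume "f i = f j"
    then show "i = j" using fdm(1)[OF xW(1)] by metis
  qed
  then have cF: "card F = N" by (simp add: F_def card_image)
  have disjF: "edge_disjoint_copies H G F"
    unfolding edge_disjoint_copies_def
  proof
    show "F \<subseteq> copies H G" using fcopy by (auto simp: F_def)
    show "pairwise (\<lambda>f g. disjnt (map_prod f f ` parcs H) (map_prod g g ` parcs H)) F"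
    proof (rule pairwiseI)
      fix a b assume "a \<in> F" "b \<in> F" "a \<noteq> b"
      then obtain i j where ij: "a = f i" "b = f j" "i \<noteq> j" by (auto simp: F_def)
      have "z \<notin> map_prod b b ` parcs H" if z: "z \<in> map_prod a a ` parcs H" for z
      proof
        assume "z \<in> map_prod b b ` parcs H"
        then obtain u v u' v' where "(u, v) \<in> parcs H" "(u', v') \<in> parcs H" "f i u = f j u'"
          using z ij by (auto simp: map_prod_def)
        moreover have "u \<in> W" "u' \<in> W" using calculation HF by (auto simp: W_def)
        ultimately show False using fdm(1)[of u i] fdm(1)[of u' j] ij by simp
      qed
      then show "disjnt (map_prod a a ` parcs H) (map_prod b b ` parcs H)" by (auto simp: disjnt_iff)
    qed
  qed
  define C where "C = (\<lambda>(r, q, r', q'). {g \<in> W \<rightarrow>\<^sub>E {..<n}. core (g r) (g q) \<and> core (g r') (g q')})"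
  define J where "J = {(r, q, r', q'). r \<in> W - {q, q'} \<and> r' \<in> W - {q, q'} \<and> q \<in> W \<and> q' \<in> W \<and> q \<noteq> q'}"
  have JW: "J \<subseteq> W \<times> W \<times> W \<times> W" by (auto simp: J_def)
  have finJ: "finite J" using JW finW finite_subset by blast
  have cJ: "card J \<le> h ^ 4"
  proof -
    have "card J \<le> card (W \<times> W \<times> W \<times> W)" using JW finW by (intro card_mono) auto
    then show ?thesis by (simp add: card_cartesian_product h_def power4_eq_xxxx mult.assoc)
  qed
  have cover: "copies H G \<subseteq> (\<Union>z\<in>J. C z)"
  proof
    fix g assume g: "g \<in> copies H G"
    have gW: "g \<in> W \<rightarrow>\<^sub>E {..<n}" using g by (auto simp: copies_def W_def G_def)
    define \<tau> where "\<tau> v = lab (g v mod p)" for v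
    have arc: "(\<tau> u, \<tau> v) \<in> R \<or> core (g u) (g v)" if "(u, v) \<in> parcs H" for u v
      using g that by (auto simp: copies_def G_def \<tau>_def)
    have weak: "(\<tau> u, \<tau> v) \<in> R \<or> (\<tau> u < 3 \<and> \<tau> v < 3 \<and> \<tau> u \<noteq> \<tau> v)" if "(u, v) \<in> parcs H" for u v
      using arc[OF that] core_lab[of "g u" "g v"] by (auto simp: \<tau>_def)
    \<comment> \<open>\<open>two\<close> at \<open>xy\<close> gives an arc outside \<open>R\<close>;
      \<open>two\<close> at that arc then gives a second one on a different edge.\<close>
    obtain r q where rq: "(r, q) \<in> parcs H" "(\<tau> r, \<tau> q) \<notin> R"
      using two[OF xy, of \<tau>] weak[OF xy] by blast
    obtain u v where uv: "(u, v) \<in> parcs H" "(u, v) \<notin> {(r, q), (q, r)}" "(\<tau> u, \<tau> v) \<notin> R"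
      using two[OF rq(1), of \<tau>] weak[OF rq(1)] by blast
    have core1: "core (g r) (g q)" "core (g q) (g r)" using arc[OF rq(1)] rq(2) core_sym by auto
    have core2: "core (g u) (g v)" "core (g v) (g u)" using arc[OF uv(1)] uv(3) core_sym by auto
    have W: "r \<in> W" "q \<in> W" "u \<in> W" "v \<in> W" "r \<noteq> q" "u \<noteq> v"
      using rq uv HF by (auto simp: W_def irrefl_def)
    have CI: "g \<in> (\<Union>z\<in>J. C z)" if "(a, b, a', b') \<in> J" "core (g a) (g b)" "core (g a') (g b')" for a b a' b'
    proof (rule UN_I[OF that(1)])
      show "g \<in> C (a, b, a', b')" using that gW by (simp add: C_def)
    qed
    \<comment> \<open>The two edges are distinct. If they share a vertex, it serves as reference for
      both other ends; otherwise each edge has a reference end of its own.\<close>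
    consider "u = r" "v \<noteq> q" | "u = q" "v \<noteq> r" | "v = r" "u \<noteq> q" | "v = q" "u \<noteq> r" | "u \<noteq> r" "u \<noteq> q" "v \<noteq> r" "v \<noteq> q"
      using uv(2) by auto
    then show "g \<in> (\<Union>z\<in>J. C z)"
    proof cases
      case 1
      then show ?thesis using CI[of r q r v] core1 core2 W by (auto simp: J_def)
    next
      case 2
      then show ?thesis using CI[of q r q v] core1 core2 W by (auto simp: J_def)
    next
      case 3
      then show ?thesis using CI[of r q r u] core1 core2 W by (auto simp: J_def)
    next
      case 4
      then show ?thesis using CI[of q r q u] core1 core2 W by (auto simp: J_def)
    next
      case 5
      then show ?thesis using CI[of r q u v] core1 core2 W by (auto simp: J_def)
    qed
  qed
  have cC: "card (C z) \<le> n ^ (h - 2) * h\<^sup>2" if "z \<in> J" for z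
  proof -
    obtain r q r' q' where z: "z = (r, q, r', q')" by (metis surj_pair)
    have "card {g \<in> W \<rightarrow>\<^sub>E {..<n}. core (g r) (g q) \<and> core (g r') (g q')} \<le> n ^ (card W - 2) * h\<^sup>2"
      by (rule card_maps_two_determined_vertices[OF finW, where p = p])
        (use that z in \<open>auto simp: J_def core_def\<close>)
    then show ?thesis by (simp add: C_def z h_def)
  qed
  have finC: "finite (C z)" for z
  proof -
    have "finite (W \<rightarrow>\<^sub>E {..<n})" using finW by (intro finite_PiE) auto
    then show ?thesis by (auto simp: C_def split: prod.split)
  qed
  have "card (copies H G) \<le> card (\<Union>z\<in>J. C z)" using finJ finC cover by (intro card_mono) auto
  also have "\<dots> \<le> (\<Sum>z\<in>J. card (C z))" using finJ by (rule card_UN_le)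
  also have "\<dots> \<le> (\<Sum>z\<in>J. n ^ (h - 2) * h\<^sup>2)" using cC by (intro sum_mono)
  also have "\<dots> = card J * (n ^ (h - 2) * h\<^sup>2)" by simp
  also have "\<dots> \<le> h ^ 4 * (n ^ (h - 2) * h\<^sup>2)" using cJ by (rule mult_right_mono) simp
  also have "\<dots> = h ^ 6 * n ^ (h - 2)" by (simp add: eval_nat_numeral mult_ac)
  finally have "real (card (copies H G)) \<le> real (h ^ 6 * n ^ (h - 2))" by (simp only: of_nat_le_iff)
  then have few: "real (card (copies H G)) \<le> real h ^ 6 * real n ^ (h - 2)" by (simp only: of_nat_mult of_nat_power)
  \<comment> \<open>Chosen so that the \<open>N\<close> block copies meet the packing condition with
    equality.\<close>
  define \<epsilon> where "\<epsilon> = real N / real n ^ 2"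
  have \<epsilon>n: "\<epsilon> * real n ^ 2 = real N" using n0 by (simp add: \<epsilon>_def)
  have "N \<le> n" unfolding n_def using hp by simp
  also have "n \<le> n ^ 2" using n0 by (simp add: power2_eq_square)
  finally have "real N \<le> real (n ^ 2)" by (simp only: of_nat_le_iff)
  then have \<epsilon>: "0 < \<epsilon>" "\<epsilon> \<le> 1" using N n0 by (auto simp: \<epsilon>_def)
  have "removal_bound \<epsilon> H \<gamma> (removal_delta \<epsilon> H \<gamma>)" using removal_delta_is_maximum(1) by blast
  then have "removal_delta \<epsilon> H \<gamma> * real n ^ card (pverts H) \<le> real (card (copies H G))"
    unfolding removal_bound_def using G cG deg disjF cF \<epsilon>n by force
  moreover have "\<mu> * \<epsilon> * real n ^ h \<le> removal_delta \<epsilon> H \<gamma> * real n ^ h"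
    using lin[OF \<epsilon>] by (intro mult_right_mono) auto
  ultimately have "\<mu> * \<epsilon> * real n ^ h \<le> real h ^ 6 * real n ^ (h - 2)"
    using few by (simp add: h_def W_def)
  moreover have "real n ^ h = real n ^ 2 * real n ^ (h - 2)"
    using h2 by (metis le_add_diff_inverse power_add)
  ultimately have "\<mu> * (\<epsilon> * real n ^ 2) * real n ^ (h - 2) \<le> real h ^ 6 * real n ^ (h - 2)"
    by (simp add: mult_ac)
  then have "\<mu> * real N \<le> real h ^ 6" using n0 by (simp add: \<epsilon>n)
  then show False using N by simp
qed

text \<open>\<open>R\<close> is complete bipartite with the colour classes \<open>0\<close> and
  \<open>1\<close> on one side and \<open>2\<close> on the other. If all edges but \<open>pq\<close>
  went to \<open>R\<close>, the sides would 2-colour \<open>H - pq\<close> and \<open>pq\<close>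
  would be critical.\<close>

lemma not_linear_removal_below_half:
  fixes H :: "'a pair_pre_digraph"
  assumes H: "pair_graph H" "chromatic_number H = 3" and xy: "(x, y) \<in> parcs H" and "\<not> has_critical_edge H"
    and \<gamma>: "0 \<le> \<gamma>" "\<gamma> < 1 / 2"
  shows "\<not> linear_removal H \<gamma>"
proof -
  obtain c where c: "proper_colouring H 3 c"
    using chromatic_number_colouring[OF ex_proper_colouring[OF H(1)]] H(2) by auto
  define R where "R = ({0, 1, 3} \<times> {2, 4} \<union> {2, 4} \<times> {0, 1, 3} :: nat rel)"
  show ?thesis
  proof (rule not_linear_removal_if_two_core_edges[OF H(1) c xy, of R 2])
    show "sym R" "irrefl R" by (auto simp: R_def sym_def irrefl_def)
    show "\<exists>b. 3 \<le> b \<and> b < 3 + 2 \<and> (a, b) \<in> R" if "a < 3 + 2" for a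
    proof -
      have "a = 0 \<or> a = 1 \<or> a = 2 \<or> a = 3 \<or> a = 4" using that by auto
      moreover have "(0, 4) \<in> R" "(1, 4) \<in> R" "(2, 3) \<in> R" "(3, 4) \<in> R" "(4, 3) \<in> R"
        by (auto simp: R_def)
      ultimately show ?thesis by (elim disjE) (auto intro: exI[of _ 3] exI[of _ 4])
    qed
    fix \<tau> :: "'a \<Rightarrow> nat" and p q
    assume pq: "(p, q) \<in> parcs H"
      and l: "\<And>u v. (u, v) \<in> parcs H \<Longrightarrow> (u, v) \<notin> {(p, q), (q, p)} \<Longrightarrow> (\<tau> u, \<tau> v) \<in> R"
    have "(\<tau> u \<in> {0, 1, 3}) \<noteq> (\<tau> v \<in> {0, 1, 3})" if "(u, v) \<in> parcs H - {(p, q), (q, p)}" for u v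
    proof -
      have "(\<tau> u, \<tau> v) \<in> R" using l that by blast
      then show ?thesis unfolding R_def by auto
    qed
    then have "\<forall>(u, v)\<in>parcs H - {(p, q), (q, p)}. (\<tau> u \<in> {0, 1, 3}) \<noteq> (\<tau> v \<in> {0, 1, 3})" by blast
    then have "critical_edge H p q"
      unfolding critical_edge_iff[OF H] using pq by (intro conjI exI[of _ "\<lambda>u. \<tau> u \<in> {0, 1, 3}"])
    then show False using assms(4) by (auto simp: has_critical_edge_def)
  qed (use \<gamma> in auto)
qed

text \<open>\<open>R\<close> is a tree in which \<open>3\<close> is the centre and \<open>0\<close>,
  \<open>1\<close>, \<open>2\<close> are leaves attached to different vertices. So \<open>R\<close>
  has no triangle, and two core classes have no common neighbour: a triangle cannot have two edges
  in \<open>R\<close> and the third between core classes.\<close>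

lemma not_linear_removal_below_third:
  fixes H :: "'a pair_pre_digraph"
  assumes H: "pair_graph H" "chromatic_number H = 3" and tri: "contains_triangle H"
    and \<gamma>: "0 \<le> \<gamma>" "\<gamma> < 1 / 3"
  shows "\<not> linear_removal H \<gamma>"
proof -
  obtain c where c: "proper_colouring H 3 c"
    using chromatic_number_colouring[OF ex_proper_colouring[OF H(1)]] H(2) by auto
  obtain x y z where t: "(x, y) \<in> parcs H" "(y, z) \<in> parcs H" "(z, x) \<in> parcs H"
    using tri by (auto simp: contains_triangle_def)
  note HF = pair_graph_arcs[OF H(1)]
  have ne: "x \<noteq> y" "y \<noteq> z" "z \<noteq> x" using t HF by (auto simp: irrefl_def)
  define R0 where "R0 = ({(0, 3), (1, 4), (2, 5), (3, 4), (3, 5)} :: nat rel)"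
  define R where "R = R0 \<union> R0\<inverse>"
  have symR: "(b, a) \<in> R" if "(a, b) \<in> R" for a b using that by (auto simp: R_def)
  have sides: "(a \<in> {1, 2, 3}) \<noteq> (b \<in> {1, 2, 3})" if "(a, b) \<in> R" for a b
    using that unfolding R_def R0_def by auto
  have low: "b = a + 3" if "(a, b) \<in> R" "a < 3" for a b
    using that unfolding R_def R0_def by auto
  have obst: False if ijk: "(i, j) \<in> R" "(j, k) \<in> R" "(k, i) \<in> R \<or> (k < 3 \<and> i < 3 \<and> k \<noteq> i)" for i j k
    using ijk(3)
  proof
    assume "(k, i) \<in> R"
    then show False using sides[OF ijk(1)] sides[OF ijk(2)] sides[of k i] by blast
  next
    assume "k < 3 \<and> i < 3 \<and> k \<noteq> i"
    then show False using low[OF ijk(1)] low[OF symR[OF ijk(2)]] by simp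
  qed
  show ?thesis
  proof (rule not_linear_removal_if_two_core_edges[OF H(1) c t(1), of R 3])
    show "sym R" using symR by (rule symI)
    show "irrefl R" by (auto simp: R_def R0_def irrefl_def)
    show "\<exists>b. 3 \<le> b \<and> b < 3 + 3 \<and> (a, b) \<in> R" if "a < 3 + 3" for a
    proof -
      have "a = 0 \<or> a = 1 \<or> a = 2 \<or> a = 3 \<or> a = 4 \<or> a = 5" using that by auto
      moreover have "(0, 3) \<in> R" "(1, 4) \<in> R" "(2, 5) \<in> R" "(3, 4) \<in> R" "(4, 3) \<in> R" "(5, 3) \<in> R"
        by (auto simp: R_def R0_def)
      ultimately show ?thesis by (elim disjE) (auto intro: exI[of _ 3] exI[of _ 4] exI[of _ 5])
    qed
    fix \<tau> :: "'a \<Rightarrow> nat" and p q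
    assume pq: "(p, q) \<in> parcs H"
      and l: "\<And>u v. (u, v) \<in> parcs H \<Longrightarrow> (u, v) \<notin> {(p, q), (q, p)} \<Longrightarrow> (\<tau> u, \<tau> v) \<in> R"
      and w: "(\<tau> p, \<tau> q) \<in> R \<or> (\<tau> p < 3 \<and> \<tau> q < 3 \<and> \<tau> p \<noteq> \<tau> q)"
    have weak: "(\<tau> u, \<tau> v) \<in> R \<or> (\<tau> u < 3 \<and> \<tau> v < 3 \<and> \<tau> u \<noteq> \<tau> v)" if "(u, v) \<in> parcs H" for u v
      using l[OF that] w symR by (cases "(u, v) \<in> {(p, q), (q, p)}") auto
    have inR: "(\<tau> u, \<tau> v) \<in> R" if "(u, v) \<in> parcs H" "{u, v} \<noteq> {p, q}" for u v
      using l[OF that(1)] that(2) by auto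
    consider "{p, q} \<noteq> {x, y}" "{p, q} \<noteq> {y, z}" | "{p, q} \<noteq> {y, z}" "{p, q} \<noteq> {z, x}"
      | "{p, q} \<noteq> {z, x}" "{p, q} \<noteq> {x, y}"
      \<comment> \<open>At most one edge of the triangle is \<open>pq\<close>; in each case the
        other two lie in \<open>R\<close>.\<close>
      using ne by (metis doubleton_eq_iff)
    then show False
    proof cases
      case 1
      then show False using obst[OF inR[OF t(1)] inR[OF t(2)] weak[OF t(3)]] by auto
    next
      case 2
      then show False using obst[OF inR[OF t(2)] inR[OF t(3)] weak[OF t(1)]] by auto
    next
      case 3
      then show False using obst[OF inR[OF t(3)] inR[OF t(1)] weak[OF t(2)]] by auto
    qed
  qed (use \<gamma> in auto)
qed

text \<open>\<open>R\<close> consists of the paths \<open>0, 3, 4, 1\<close> and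
  \<open>2, 5, 6\<close>. An additional edge between core classes closes a cycle of length 4 or
  joins the two paths, so the label graph remains bipartite and cannot receive
  \<open>H\<close>.\<close>

lemma not_linear_removal_below_quarter:
  fixes H :: "'a pair_pre_digraph"
  assumes H: "pair_graph H" "chromatic_number H = 3" and xy: "(x, y) \<in> parcs H"
    and \<gamma>: "0 \<le> \<gamma>" "\<gamma> < 1 / 4"
  shows "\<not> linear_removal H \<gamma>"
proof -
  obtain c where c: "proper_colouring H 3 c"
    using chromatic_number_colouring[OF ex_proper_colouring[OF H(1)]] H(2) by auto
  define R0 where "R0 = ({(0, 3), (1, 4), (2, 5), (3, 4), (5, 6)} :: nat rel)"
  define R where "R = R0 \<union> R0\<inverse>"
  have symR: "(b, a) \<in> R" if "(a, b) \<in> R" for a b using that by (auto simp: R_def)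
  show ?thesis
  proof (rule not_linear_removal_if_two_core_edges[OF H(1) c xy, of R 4])
    show "sym R" using symR by (rule symI)
    show "irrefl R" by (auto simp: R_def R0_def irrefl_def)
    show "\<exists>b. 3 \<le> b \<and> b < 3 + 4 \<and> (a, b) \<in> R" if "a < 3 + 4" for a
    proof -
      have "a = 0 \<or> a = 1 \<or> a = 2 \<or> a = 3 \<or> a = 4 \<or> a = 5 \<or> a = 6" using that by auto
      moreover have "(0, 3) \<in> R" "(1, 4) \<in> R" "(2, 5) \<in> R" "(3, 4) \<in> R" "(4, 3) \<in> R" "(5, 6) \<in> R" "(6, 5) \<in> R"
        by (auto simp: R_def R0_def)
      ultimately show ?thesis
        by (elim disjE) (auto intro: exI[of _ 3] exI[of _ 4] exI[of _ 5] exI[of _ 6])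
    qed
    fix \<tau> :: "'a \<Rightarrow> nat" and p q
    assume pq: "(p, q) \<in> parcs H"
      and l: "\<And>u v. (u, v) \<in> parcs H \<Longrightarrow> (u, v) \<notin> {(p, q), (q, p)} \<Longrightarrow> (\<tau> u, \<tau> v) \<in> R"
      and w: "(\<tau> p, \<tau> q) \<in> R \<or> (\<tau> p < 3 \<and> \<tau> q < 3 \<and> \<tau> p \<noteq> \<tau> q)"
    \<comment> \<open>The component of the label 2 may be recoloured, so any one edge between core classes can be added.\<close>
    define flip where "flip \<longleftrightarrow> {\<tau> p, \<tau> q} = {0, 2}"
    define \<kappa> where "\<kappa> a \<longleftrightarrow> a \<in> (if flip then {0, 4, 5} else {0, 2, 4, 6})" for a :: nat
    have R\<kappa>: "\<kappa> a \<noteq> \<kappa> b" if "(a, b) \<in> R" for a b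
      using that unfolding \<kappa>_def R_def R0_def by (cases flip) auto
    have "\<kappa> (\<tau> p) \<noteq> \<kappa> (\<tau> q)"
      using w
    proof
      assume "\<tau> p < 3 \<and> \<tau> q < 3 \<and> \<tau> p \<noteq> \<tau> q"
      moreover have "a = 0 \<or> a = 1 \<or> a = 2" if "a < 3" for a :: nat using that by auto
      ultimately consider "flip" "\<tau> p = 0" "\<tau> q = 2" | "flip" "\<tau> p = 2" "\<tau> q = 0"
        | "\<not> flip" "\<tau> p = 1" "\<tau> q \<in> {0, 2}" | "\<not> flip" "\<tau> q = 1" "\<tau> p \<in> {0, 2}"
        unfolding flip_def doubleton_eq_iff by (metis insertCI zero_neq_numeral one_neq_zero)
      then show ?thesis by cases (auto simp: \<kappa>_def)
    qed (rule R\<kappa>)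
    then have "\<kappa> (\<tau> u) \<noteq> \<kappa> (\<tau> v)" if "(u, v) \<in> parcs H" for u v
      using R\<kappa>[OF l[OF that]] by auto
    then show False by (rule not_two_colourable[OF H, of "\<lambda>u. \<kappa> (\<tau> u)"])
  qed (use \<gamma> in auto)
qed

section \<open>The three thresholds\<close>

lemma lin_rem_threshold_eqI:
  fixes \<gamma> :: real
  assumes "0 \<le> \<gamma>" "\<gamma> < 1" "\<And>\<gamma>'. \<gamma> < \<gamma>' \<Longrightarrow> \<gamma>' \<le> 1 \<Longrightarrow> linear_removal H \<gamma>'"
    and "\<And>\<gamma>'. 0 \<le> \<gamma>' \<Longrightarrow> \<gamma>' < \<gamma> \<Longrightarrow> \<not> linear_removal H \<gamma>'"
  shows "lin_rem_threshold H = \<gamma>"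
proof -
  let ?A = "{\<gamma> \<in> {0..1}. linear_removal H \<gamma>}"
  have one: "1 \<in> ?A" using assms(2,3) by simp
  have lower: "\<gamma> \<le> a" if "a \<in> ?A" for a using that assms(4)[of a] by force
  have "\<gamma> \<le> Inf ?A" using one lower by (intro cInf_greatest) auto
  moreover have "Inf ?A \<le> a" if "\<gamma> < a" for a
  proof -
    have "min a 1 \<in> ?A" using that assms by auto
    then have "Inf ?A \<le> min a 1" by (intro cInf_lower bdd_belowI[of _ \<gamma>]) (use lower in auto)
    then show ?thesis by simp
  qed
  then have "Inf ?A \<le> \<gamma>" by (rule dense_ge)
  ultimately show ?thesis by (simp add: lin_rem_threshold_def)
qed

theorem theorem1p2:
  fixes H :: "'a pair_pre_digraph"
  assumes "pair_graph H"
    and "chromatic_number H = 3"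
  shows "(\<not> has_critical_edge H \<longrightarrow> lin_rem_threshold H = 1 / 2) \<and>
    (has_critical_edge H \<and> contains_triangle H \<longrightarrow> lin_rem_threshold H = 1 / 3) \<and>
    (has_critical_edge H \<and> odd_girth H \<ge> 5 \<longrightarrow> lin_rem_threshold H = 1 / 4)"
proof (intro conjI impI)
  assume "\<not> has_critical_edge H"
  moreover obtain x y where xy: "(x, y) \<in> parcs H"
    using not_two_colourable[OF assms, of "\<lambda>_. True"] by auto
  ultimately show "lin_rem_threshold H = 1 / 2"
    using linear_removal_if_forcing[OF assms(1) xy forcing_half[OF assms xy]]
      not_linear_removal_below_half[OF assms xy]
    by (intro lin_rem_threshold_eqI) auto
next
  assume "has_critical_edge H \<and> contains_triangle H"
  then obtain x y where crit: "critical_edge H x y" and tri: "contains_triangle H"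
    by (auto simp: has_critical_edge_def)
  have xy: "(x, y) \<in> parcs H" using crit by (simp add: critical_edge_def)
  show "lin_rem_threshold H = 1 / 3"
    using linear_removal_if_forcing[OF assms(1) xy forcing_third[OF assms crit tri]]
      not_linear_removal_below_third[OF assms tri]
    by (intro lin_rem_threshold_eqI) auto
next
  assume "has_critical_edge H \<and> odd_girth H \<ge> 5"
  then obtain x y where crit: "critical_edge H x y" and girth: "odd_girth H \<ge> 5"
    by (auto simp: has_critical_edge_def)
  have xy: "(x, y) \<in> parcs H" using crit by (simp add: critical_edge_def)
  show "lin_rem_threshold H = 1 / 4"
    using linear_removal_if_forcing[OF assms(1) xy forcing_quarter[OF assms crit odd_girth_triangle[OF assms(1) girth]]]
      not_linear_removal_below_quarter[OF assms xy]
    by (intro lin_rem_threshold_eqI) auto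
qed

end
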